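(* Let $\operatorname{char}K=2$, let $\mathbf R$ be the Lie algebra generated by $\{v_0,v_1\}$ (using the bracket only, without $p$-mapping), and let $a_n=\dim\mathbf R_n=\dim\mathbf R^n/\mathbf R^{n+1}$, $n\ge 1$. Then: (i) the sequence $(a_n)$, starting with $n=5$, consists of alternating parts of two kinds: a block $1,1$ followed either by $2$ or by a block $2,2,2$; that is, $(a_n)_{n\ge 5}$ is an infinite concatenation of blocks, each of which is $1,1,2$ or $1,1,2,2,2$; (ii) the sequence $(a_n\mid n\ge 1)$ is not eventually periodic.
   Context: Let $\Lambda=\Lambda(x_i\mid i\ge 0)$ be the Grassmann (exterior) algebra over a field $K$ of characteristic $2$ on generators $x_0,x_1,\dots$ ($x_ix_j=x_jx_i$, $x_i^2=0$). In $\operatorname{End}\Lambda$ identify $x_i$ with left multiplication by $x_i$, and let $\partial_i$ be the derivation of $\Lambda$ with $\partial_i(x_j)=\delta_{ij}$ (in characteristic $2$ superderivations are ordinary derivations). The pivot elements are $v_i=\partial_i+x_ix_{i+1}(\partial_{i+2}+x_{i+2}x_{i+3}(\partial_{i+4}+\cdots))$, $i\ge 0$, that is, $v_i=\partial_i+x_ix_{i+1}v_{i+2}$ (well defined on $\Lambda$, since each element involves finitely many letters). $\mathbf R$ is the smallest subspace of $\operatorname{End}\Lambda$ containing $v_0,v_1$ and closed under $[a,b]=ab+ba$. $\mathbf R=\bigoplus_{n\ge 1}\mathbf R_n$ is the $\mathbb N$-gradation in which $\mathbf R_n$ is spanned by commutators of length $n$ in $v_0,v_1$; $(\mathbf R^n)$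 is the lower central series $\mathbf R^1=\mathbf R$, $\mathbf R^n=[\mathbf R,\mathbf R^{n-1}]$. *)

theory Defs
  imports Complex_Main "HOL-Library.Function_Algebras"
begin

section \<open>The Grassmann algebra in characteristic 2\<close>

text \<open>
  In characteristic 2 the exterior algebra on \<open>x\<^sub>0, x\<^sub>1, \<dots>\<close> is the commutative algebra with
  \<open>x\<^sub>i\<^sup>2 = 0\<close>. It has the squarefree monomials as a basis, so an element is given by its coefficient
  function on finite sets of indices. No signs occur, hence over a field of another
  characteristic the type below is not the exterior algebra.
\<close>

typedef (overloaded) 'k grassmann =
  "{f :: nat set \<Rightarrow> 'k::zero. finite {S. f S \<noteq> 0} \<and> (\<forall>S. f S \<noteq> 0 \<longrightarrow> finite S)}"
  morphisms gcoeff Abs_grassmann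
  by (rule exI[of _ "\<lambda>_. 0"]) simp

setup_lifting type_definition_grassmann

lemma grassmann_eqI: "(\<And>S. finite S \<Longrightarrow> gcoeff f S = gcoeff g S) \<Longrightarrow> f = g"
proof (transfer, rule ext)
  fix f g :: "nat set \<Rightarrow> 'a" and S
  assume "finite {S. f S \<noteq> 0} \<and> (\<forall>S. f S \<noteq> 0 \<longrightarrow> finite S)"
    "finite {S. g S \<noteq> 0} \<and> (\<forall>S. g S \<noteq> 0 \<longrightarrow> finite S)" "\<And>S. finite S \<Longrightarrow> f S = g S"
  then show "f S = g S" by metis
qed

lemma finite_gcoeff_support: "finite {S. gcoeff f S \<noteq> 0}"
  by transfer simp

lemma gcoeff_infinite: "infinite S \<Longrightarrow> gcoeff f S = 0"
  by transfer auto

instantiation grassmann :: (ab_group_add) ab_group_add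
begin

lift_definition zero_grassmann :: "'a grassmann" is "\<lambda>_. 0" by simp

lift_definition plus_grassmann :: "'a grassmann \<Rightarrow> 'a grassmann \<Rightarrow> 'a grassmann"
  is "\<lambda>f g S. f S + g S"
proof -
  fix f g :: "nat set \<Rightarrow> 'a"
  assume f: "finite {S. f S \<noteq> 0} \<and> (\<forall>S. f S \<noteq> 0 \<longrightarrow> finite S)"
    and g: "finite {S. g S \<noteq> 0} \<and> (\<forall>S. g S \<noteq> 0 \<longrightarrow> finite S)"
  have sub: "{S. f S + g S \<noteq> 0} \<subseteq> {S. f S \<noteq> 0} \<union> {S. g S \<noteq> 0}" by auto
  have "finite {S. f S + g S \<noteq> 0}" by (rule finite_subset[OF sub]) (use f g in simp)
  then show "finite {S. f S + g S \<noteq> 0} \<and> (\<forall>S. f S + g S \<noteq> 0 \<longrightarrow> finite S)"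
    using f g by (metis add.right_neutral)
qed

lift_definition uminus_grassmann :: "'a grassmann \<Rightarrow> 'a grassmann"
  is "\<lambda>f S. - f S" by simp

definition minus_grassmann :: "'a grassmann \<Rightarrow> 'a grassmann \<Rightarrow> 'a grassmann"
  where "minus_grassmann f g = f + (- g)"

instance
  by standard (rule grassmann_eqI; simp add: minus_grassmann_def zero_grassmann.rep_eq
      plus_grassmann.rep_eq uminus_grassmann.rep_eq algebra_simps)+

end

lemma gcoeff_simps [simp]:
  "gcoeff 0 S = 0" "gcoeff (f + g) S = gcoeff f S + gcoeff g S" "gcoeff (- f) S = - gcoeff f S"
  by (simp_all add: zero_grassmann.rep_eq plus_grassmann.rep_eq uminus_grassmann.rep_eq)

lemma gcoeff_minus [simp]: "gcoeff (f - g) S = gcoeff f S - gcoeff g S"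
  unfolding minus_grassmann_def gcoeff_simps by simp

lemma gcoeff_sum: "gcoeff (sum h A) S = (\<Sum>a\<in>A. gcoeff (h a) S)"
  by (induction A rule: infinite_finite_induct) auto

instantiation grassmann :: (comm_ring_1) comm_ring_1
begin

lift_definition one_grassmann :: "'a grassmann" is "\<lambda>S. if S = {} then 1 else 0" by auto

lift_definition times_grassmann :: "'a grassmann \<Rightarrow> 'a grassmann \<Rightarrow> 'a grassmann"
  is "\<lambda>f g S. \<Sum>T\<in>Pow S. f T * g (S - T)"
proof -
  fix f g :: "nat set \<Rightarrow> 'a"
  assume f: "finite {S. f S \<noteq> 0} \<and> (\<forall>S. f S \<noteq> 0 \<longrightarrow> finite S)"
    and g: "finite {S. g S \<noteq> 0} \<and> (\<forall>S. g S \<noteq> 0 \<longrightarrow> finite S)"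
  let ?p = "\<lambda>S. \<Sum>T\<in>Pow S. f T * g (S - T)"
  have "{S. ?p S \<noteq> 0} \<subseteq> (\<lambda>(A, B). A \<union> B) ` ({S. f S \<noteq> 0} \<times> {S. g S \<noteq> 0})"
  proof
    fix S assume "S \<in> {S. ?p S \<noteq> 0}"
    then have "?p S \<noteq> 0" by simp
    then obtain T where T: "T \<in> Pow S" "f T * g (S - T) \<noteq> 0"
      by (rule sum.not_neutral_contains_not_neutral)
    then have "f T \<noteq> 0" "g (S - T) \<noteq> 0" "S = T \<union> (S - T)" by auto
    then show "S \<in> (\<lambda>(A, B). A \<union> B) ` ({S. f S \<noteq> 0} \<times> {S. g S \<noteq> 0})" by blast
  qed
  then have "finite {S. ?p S \<noteq> 0}"
    by (rule finite_subset) (use f g in blast)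
  moreover have "finite S" if "?p S \<noteq> 0" for S
  proof (rule ccontr)
    assume "infinite S"
    then have "infinite (Pow S)" by simp
    then show False using that sum.infinite by blast
  qed
  ultimately show "finite {S. ?p S \<noteq> 0} \<and> (\<forall>S. ?p S \<noteq> 0 \<longrightarrow> finite S)" by blast
qed

instance
proof
  fix a b c :: "'a grassmann"
  show "a * b * c = a * (b * c)"
  proof (rule grassmann_eqI)
    fix U :: "nat set" assume U: "finite U"
    have fin: "finite S" if "S \<subseteq> U" for S using U that finite_subset by blast
    have "gcoeff (a * b * c) U =
        (\<Sum>S\<in>Pow U. \<Sum>T\<in>Pow S. gcoeff a T * gcoeff b (S - T) * gcoeff c (U - S))"
      by (simp add: times_grassmann.rep_eq sum_distrib_right)
    also have "\<dots> = (\<Sum>(S, T)\<in>(SIGMA S:Pow U. Pow S).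
        gcoeff a T * gcoeff b (S - T) * gcoeff c (U - S))"
      using U fin by (subst sum.Sigma) auto
    also have "\<dots> = (\<Sum>(T, P)\<in>(SIGMA T:Pow U. Pow (U - T)).
        gcoeff a T * (gcoeff b P * gcoeff c (U - T - P)))"
    proof (rule sum.reindex_bij_witness[where i = "\<lambda>(T, P). (T \<union> P, T)" and j = "\<lambda>(S, T). (T, S - T)"],
        goal_cases)
      case (5 p)
      then obtain S T where p: "p = (S, T)" "T \<subseteq> S" "S \<subseteq> U" by auto
      then have "U - T - (S - T) = U - S" by blast
      then show ?case using p by (simp add: mult.assoc)
    qed auto
    also have "\<dots> = (\<Sum>T\<in>Pow U. \<Sum>P\<in>Pow (U - T).
        gcoeff a T * (gcoeff b P * gcoeff c (U - T - P)))"
      using U by (subst sum.Sigma) auto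
    also have "\<dots> = gcoeff (a * (b * c)) U"
      by (simp add: times_grassmann.rep_eq sum_distrib_left)
    finally show "gcoeff (a * b * c) U = gcoeff (a * (b * c)) U" .
  qed
  show "a * b = b * a"
  proof (rule grassmann_eqI)
    fix U :: "nat set" assume "finite U"
    show "gcoeff (a * b) U = gcoeff (b * a) U"
      unfolding times_grassmann.rep_eq
      by (rule sum.reindex_bij_witness[where i = "\<lambda>T. U - T" and j = "\<lambda>T. U - T"])
        (auto simp: double_diff mult.commute)
  qed
  show "1 * a = a"
  proof (rule grassmann_eqI)
    fix U :: "nat set" assume U: "finite U"
    have "gcoeff (1 * a) U = (\<Sum>T\<in>Pow U. if T = {} then gcoeff a U else 0)"
      unfolding times_grassmann.rep_eq one_grassmann.rep_eq by (rule sum.cong) auto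
    then show "gcoeff (1 * a) U = gcoeff a U" using U by (simp add: sum.delta)
  qed
  show "(a + b) * c = a * c + b * c"
    by (rule grassmann_eqI) (simp add: times_grassmann.rep_eq algebra_simps sum.distrib)
  show "(0 :: 'a grassmann) \<noteq> 1"
  proof
    assume "(0 :: 'a grassmann) = 1"
    then have "gcoeff (0 :: 'a grassmann) {} = gcoeff 1 {}" by simp
    then show False by (simp add: one_grassmann.rep_eq)
  qed
qed

end

lift_definition gscale :: "'k::comm_ring_1 \<Rightarrow> 'k grassmann \<Rightarrow> 'k grassmann"
  is "\<lambda>c f S. c * f S"
proof -
  fix c :: 'k and f :: "nat set \<Rightarrow> 'k"
  assume f: "finite {S. f S \<noteq> 0} \<and> (\<forall>S. f S \<noteq> 0 \<longrightarrow> finite S)"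
  have "{S. c * f S \<noteq> 0} \<subseteq> {S. f S \<noteq> 0}" by auto
  then have "finite {S. c * f S \<noteq> 0}" by (rule finite_subset) (use f in blast)
  then show "finite {S. c * f S \<noteq> 0} \<and> (\<forall>S. c * f S \<noteq> 0 \<longrightarrow> finite S)"
    using f mult_zero_right by metis
qed

lemma gcoeff_gscale [simp]: "gcoeff (gscale c f) S = c * gcoeff f S"
  by (simp add: gscale.rep_eq)

global_interpretation grass: vector_space "gscale :: 'k::field \<Rightarrow> 'k grassmann \<Rightarrow> 'k grassmann"
  by standard (rule grassmann_eqI; simp add: algebra_simps)+

lemma gscale_mult: "gscale c (f * g) = gscale c f * g" "gscale c (f * g) = f * gscale c g"
  by (rule grassmann_eqI; simp add: times_grassmann.rep_eq sum_distrib_left mult.assoc mult.left_commute)+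

lift_definition gmonom :: "nat set \<Rightarrow> 'k::comm_ring_1 grassmann"
  is "\<lambda>U S. if finite U \<and> S = U then 1 else 0" by auto

definition gen :: "nat \<Rightarrow> 'k::comm_ring_1 grassmann"
  where "gen i = gmonom {i}"

lemma gmonom_empty: "gmonom {} = 1"
  by transfer auto

lemma gen_mult_coeff:
  assumes "finite S"
  shows "gcoeff (gen i * f) S = (if i \<in> S then gcoeff f (S - {i}) else 0)"
proof -
  have "gcoeff (gen i * f) S = (\<Sum>T\<in>Pow S. if T = {i} then gcoeff f (S - {i}) else 0)"
    unfolding times_grassmann.rep_eq gen_def gmonom.rep_eq by (rule sum.cong) auto
  then show ?thesis using assms by (simp add: sum.delta)
qed

lemma gen_mult_gmonom:
  assumes "finite S"
  shows "gen i * gmonom S = (if i \<in> S then 0 else gmonom (insert i S))"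
  by (rule grassmann_eqI) (auto simp: gen_mult_coeff gmonom.rep_eq assms)

lemma gen_square: "gen i * gen i = 0"
  using gen_mult_gmonom[of "{i}" i] by (simp add: gen_def)

lemma prod_gen: "finite S \<Longrightarrow> (\<Prod>i\<in>S. gen i) = gmonom S"
  by (induction S rule: finite_induct) (auto simp: gmonom_empty gen_mult_gmonom)

lemma grassmann_expand:
  "f = (\<Sum>S | gcoeff f S \<noteq> 0. gscale (gcoeff f S) (gmonom S))"
proof (rule grassmann_eqI)
  fix U :: "nat set" assume U: "finite U"
  have "gcoeff (\<Sum>S | gcoeff f S \<noteq> 0. gscale (gcoeff f S) (gmonom S)) U =
      (\<Sum>S | gcoeff f S \<noteq> 0. if S = U then gcoeff f U else 0)"
    unfolding gcoeff_sum using U by (intro sum.cong) (auto simp: gmonom.rep_eq)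
  also have "\<dots> = gcoeff f U"
    using finite_gcoeff_support[of f] by (simp add: sum.delta)
  finally show "gcoeff f U = gcoeff (\<Sum>S | gcoeff f S \<noteq> 0. gscale (gcoeff f S) (gmonom S)) U" by simp
qed


section \<open>The partial derivations and the pivot elements\<close>

definition is_derivation :: "('k::field grassmann \<Rightarrow> 'k grassmann) \<Rightarrow> bool"
  where "is_derivation D \<longleftrightarrow> Vector_Spaces.linear gscale gscale D \<and> (\<forall>f g. D (f * g) = D f * g + f * D g)"

text \<open>
  \<open>\<partial>\<^sub>i\<close> sends a monomial containing \<open>x\<^sub>i\<close> to the monomial with \<open>x\<^sub>i\<close> removed, and all other monomials
  to 0. Lemma \<open>gpartial_unique\<close> below shows that in characteristic 2 it is the derivation
  with \<open>\<partial>\<^sub>i(x\<^sub>j) = \<delta>\<^sub>i\<^sub>j\<close>.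
\<close>

lift_definition gpartial :: "nat \<Rightarrow> 'k::comm_ring_1 grassmann \<Rightarrow> 'k grassmann"
  is "\<lambda>i f S. if i \<in> S then 0 else f (insert i S)"
proof -
  fix i and f :: "nat set \<Rightarrow> 'k"
  assume f: "finite {S. f S \<noteq> 0} \<and> (\<forall>S. f S \<noteq> 0 \<longrightarrow> finite S)"
  let ?g = "\<lambda>S. if i \<in> S then 0 else f (insert i S)"
  have "{S. ?g S \<noteq> 0} \<subseteq> (\<lambda>S. S - {i}) ` {S. f S \<noteq> 0}"
  proof
    fix S assume "S \<in> {S. ?g S \<noteq> 0}"
    then have "S = insert i S - {i}" "f (insert i S) \<noteq> 0" by (auto split: if_splits)
    then show "S \<in> (\<lambda>S. S - {i}) ` {S. f S \<noteq> 0}" by blast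
  qed
  then have "finite {S. ?g S \<noteq> 0}" by (rule finite_subset) (use f in blast)
  moreover have "\<forall>S. ?g S \<noteq> 0 \<longrightarrow> finite S" using f by (metis finite_insert)
  ultimately show "finite {S. ?g S \<noteq> 0} \<and> (\<forall>S. ?g S \<noteq> 0 \<longrightarrow> finite S)" by blast
qed

lemma gpartial_linear: "Vector_Spaces.linear gscale gscale (gpartial i :: 'k::field grassmann \<Rightarrow> _)"
  unfolding module_hom_iff_linear[symmetric] module_hom_iff
  by (auto intro!: grass.module_axioms grassmann_eqI simp: gpartial.rep_eq)

lemma gpartial_gen: "gpartial i (gen j) = (if i = j then 1 else 0)"
  by (rule grassmann_eqI) (auto simp: gpartial.rep_eq gen_def gmonom.rep_eq one_grassmann.rep_eq)

lemma sum_Pow_insert: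
  fixes h :: "nat set \<Rightarrow> 'b::comm_monoid_add"
  assumes "finite S" "i \<notin> S"
  shows "(\<Sum>T\<in>Pow (insert i S). h T) = (\<Sum>T\<in>Pow S. h T) + (\<Sum>T\<in>Pow S. h (insert i T))"
proof -
  have "inj_on (insert i) (Pow S)" using assms(2) by (auto simp: inj_on_def)
  then have "sum h (insert i ` Pow S) = (\<Sum>T\<in>Pow S. h (insert i T))"
    by (simp add: sum.reindex)
  moreover have "sum h (Pow S \<union> insert i ` Pow S) = sum h (Pow S) + sum h (insert i ` Pow S)"
    using assms by (intro sum.union_disjoint) auto
  ultimately show ?thesis by (simp add: Pow_insert)
qed

lemma char2_double:
  fixes c :: "'k::comm_ring_1"
  assumes "CHAR('k) = 2"
  shows "c + c = 0"
proof -
  have "of_nat 2 = (0 :: 'k)" using of_nat_CHAR[where 'a = 'k] unfolding assms .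
  moreover have "c + c = of_nat 2 * c" by (simp only: of_nat_numeral mult_2)
  ultimately show ?thesis by (simp only: mult_zero_left)
qed

lemma gpartial_mult:
  fixes f g :: "'k::comm_ring_1 grassmann"
  assumes char2: "CHAR('k) = 2"
  shows "gpartial i (f * g) = gpartial i f * g + f * gpartial i g"
proof (rule grassmann_eqI)
  fix S :: "nat set" assume S: "finite S"
  show "gcoeff (gpartial i (f * g)) S = gcoeff (gpartial i f * g + f * gpartial i g) S"
  proof (cases "i \<in> S")
    case False
    have 1: "(\<Sum>T\<in>Pow S. gcoeff f T * gcoeff g (insert i S - T)) =
        (\<Sum>T\<in>Pow S. gcoeff f T * gcoeff (gpartial i g) (S - T))"
      using False by (intro sum.cong refl) (auto simp: gpartial.rep_eq insert_Diff_if)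
    have 2: "(\<Sum>T\<in>Pow S. gcoeff f (insert i T) * gcoeff g (insert i S - insert i T)) =
        (\<Sum>T\<in>Pow S. gcoeff (gpartial i f) T * gcoeff g (S - T))"
    proof (intro sum.cong refl)
      fix T assume "T \<in> Pow S"
      then have "insert i S - insert i T = S - T" "i \<notin> T" using False by auto
      then show "gcoeff f (insert i T) * gcoeff g (insert i S - insert i T) =
          gcoeff (gpartial i f) T * gcoeff g (S - T)"
        by (simp add: gpartial.rep_eq)
    qed
    have "gcoeff (gpartial i (f * g)) S = gcoeff (f * g) (insert i S)"
      using False by (simp add: gpartial.rep_eq)
    then show ?thesis
      unfolding gcoeff_simps times_grassmann.rep_eq sum_Pow_insert[OF S False] 1 2
      by (simp add: add.commute)
  next
    case True
    define U where "U = S - {i}"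
    have U: "finite U" "i \<notin> U" "S = insert i U" using S True by (auto simp: U_def)
    have a: "(\<Sum>T\<in>Pow U. gcoeff (gpartial i f) T * gcoeff g (insert i U - T)) =
        (\<Sum>T\<in>Pow U. gcoeff f (insert i T) * gcoeff g (insert i (U - T)))"
      using U(2) by (intro sum.cong refl) (auto simp: gpartial.rep_eq insert_Diff_if)
    have b: "(\<Sum>T\<in>Pow U. gcoeff (gpartial i f) (insert i T) * gcoeff g (insert i U - insert i T)) = 0"
      by (simp add: gpartial.rep_eq)
    have c: "(\<Sum>T\<in>Pow U. gcoeff f T * gcoeff (gpartial i g) (insert i U - T)) = 0"
      using U(2) by (intro sum.neutral) (auto simp: gpartial.rep_eq)
    have d: "(\<Sum>T\<in>Pow U. gcoeff f (insert i T) * gcoeff (gpartial i g) (insert i U - insert i T)) =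
        (\<Sum>T\<in>Pow U. gcoeff f (insert i T) * gcoeff g (insert i (U - T)))"
    proof (intro sum.cong refl)
      fix T assume "T \<in> Pow U"
      then have "insert i U - insert i T = U - T" "i \<notin> U - T" using U(2) by auto
      moreover have "gcoeff (gpartial i g) (U - T) = gcoeff g (insert i (U - T))"
        using U(2) by (simp add: gpartial.rep_eq)
      ultimately show "gcoeff f (insert i T) * gcoeff (gpartial i g) (insert i U - insert i T) =
          gcoeff f (insert i T) * gcoeff g (insert i (U - T))"
        by (simp only:)
    qed
    have "gcoeff (gpartial i (f * g)) S = 0" using True by (simp add: gpartial.rep_eq)
    then show ?thesis
      unfolding gcoeff_simps times_grassmann.rep_eq U(3) sum_Pow_insert[OF U(1,2)] a b c d
      by (simp add: char2_double[OF char2])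
  qed
qed

lemma gpartial_derivation:
  fixes i :: nat
  assumes "CHAR('k::field) = 2"
  shows "is_derivation (gpartial i :: 'k grassmann \<Rightarrow> 'k grassmann)"
  unfolding is_derivation_def by (simp add: gpartial_linear gpartial_mult[OF assms])

lemma gpartial_unique:
  fixes D :: "'k::field grassmann \<Rightarrow> 'k grassmann"
  assumes char2: "CHAR('k) = 2" and D: "is_derivation D"
    and Dgen: "\<And>j. D (gen j) = (if i = j then 1 else 0)"
  shows "D = gpartial i"
proof -
  interpret D: Vector_Spaces.linear gscale gscale D using D by (simp add: is_derivation_def)
  interpret P: Vector_Spaces.linear gscale gscale "gpartial i :: 'k grassmann \<Rightarrow> _" by (rule gpartial_linear)
  have Dm: "D (f * g) = D f * g + f * D g" for f g using D by (simp add: is_derivation_def)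
  have D1: "D 1 = 0" using Dm[of 1 1] by simp
  have mono: "D (gmonom S) = gpartial i (gmonom S)" if "finite S" for S
    using that
  proof (induction S rule: finite_induct)
    case empty
    have "gpartial i (1 :: 'k grassmann) = 0"
      by (rule grassmann_eqI) (simp add: gpartial.rep_eq one_grassmann.rep_eq)
    then show ?case by (simp add: gmonom_empty D1)
  next
    case (insert j S)
    have "gmonom (insert j S) = gen j * (gmonom S :: 'k grassmann)"
      using insert by (simp add: gen_mult_gmonom)
    then show ?case using insert by (simp add: Dm Dgen gpartial_mult[OF char2] gpartial_gen)
  qed
  show ?thesis
  proof
    fix f :: "'k grassmann"
    let ?A = "{S. gcoeff f S \<noteq> 0}"
    have "D f = D (\<Sum>S\<in>?A. gscale (gcoeff f S) (gmonom S))"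
      using grassmann_expand[of f] by (rule arg_cong)
    also have "\<dots> = (\<Sum>S\<in>?A. gscale (gcoeff f S) (D (gmonom S)))"
      by (simp only: D.sum D.scale)
    also have "\<dots> = (\<Sum>S\<in>?A. gscale (gcoeff f S) (gpartial i (gmonom S)))"
    proof (intro sum.cong refl)
      fix S assume "S \<in> ?A"
      then have "finite S" using gcoeff_infinite by blast
      then show "gscale (gcoeff f S) (D (gmonom S)) = gscale (gcoeff f S) (gpartial i (gmonom S))"
        by (simp add: mono)
    qed
    also have "\<dots> = gpartial i (\<Sum>S\<in>?A. gscale (gcoeff f S) (gmonom S))"
      by (simp only: P.sum P.scale)
    also have "\<dots> = gpartial i f"
      using grassmann_expand[of f, symmetric] by (rule arg_cong)
    finally show "D f = gpartial i f" .
  qed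
qed

text \<open>
  Unfolding \<open>v\<^sub>i = \<partial>\<^sub>i + x\<^sub>i x\<^sub>i\<^sub>+\<^sub>1 v\<^sub>i\<^sub>+\<^sub>2\<close> gives \<open>v\<^sub>i = \<Sum>\<^sub>k x\<^sub>i x\<^sub>i\<^sub>+\<^sub>1 \<dots> x\<^bsub>i+2k-1\<^esub> \<partial>\<^bsub>i+2k\<^esub>\<close>. On a given element
  only finitely many summands are nonzero, and the sum runs over a set containing these.
\<close>

definition pivot :: "nat \<Rightarrow> 'k::comm_ring_1 grassmann \<Rightarrow> 'k grassmann"
  where "pivot i f =
    (\<Sum>k | gpartial (i + 2 * k) f \<noteq> 0. (\<Prod>j = i..<i + 2 * k. gen j) * gpartial (i + 2 * k) f)"

lemma finite_gpartial_support: "finite {k. gpartial (i + 2 * k) f \<noteq> 0}"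
proof -
  let ?V = "\<Union>{S. gcoeff f S \<noteq> 0}"
  have fin: "finite ?V"
    using finite_gcoeff_support[of f] gcoeff_infinite[of _ f] by blast
  have "k \<in> ?V" if "gpartial k f \<noteq> 0" for k
  proof -
    have "\<exists>S. gcoeff (gpartial k f) S \<noteq> 0" using that grassmann_eqI[of "gpartial k f" 0] by auto
    then show ?thesis by (auto simp: gpartial.rep_eq split: if_splits)
  qed
  then have "(\<lambda>k. i + 2 * k) ` {k. gpartial (i + 2 * k) f \<noteq> 0} \<subseteq> ?V" by blast
  then have "finite ((\<lambda>k. i + 2 * k) ` {k. gpartial (i + 2 * k) f \<noteq> 0})"
    using fin finite_subset by blast
  then show ?thesis by (rule finite_imageD) (auto simp: inj_on_def)
qed

lemma pivot_eq_sum: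
  assumes "finite A" "{k. gpartial (i + 2 * k) f \<noteq> 0} \<subseteq> A"
  shows "pivot i f = (\<Sum>k\<in>A. (\<Prod>j = i..<i + 2 * k. gen j) * gpartial (i + 2 * k) f)"
  unfolding pivot_def using assms by (intro sum.mono_neutral_left) auto

lemma pivot_rec: "pivot i f = gpartial i f + gen i * gen (i + 1) * pivot (i + 2) f"
proof -
  have "finite ({k. gpartial (i + 2 * k) f \<noteq> 0} \<union> {k. gpartial (i + 2 + 2 * k) f \<noteq> 0})"
    using finite_gpartial_support by blast
  then obtain n where n: "\<forall>k\<in>{k. gpartial (i + 2 * k) f \<noteq> 0} \<union> {k. gpartial (i + 2 + 2 * k) f \<noteq> 0}. k < n"
    using finite_nat_set_iff_bounded by blast
  have 1: "pivot i f = (\<Sum>k<Suc n. (\<Prod>j = i..<i + 2 * k. gen j) * gpartial (i + 2 * k) f)"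
    by (rule pivot_eq_sum) (use n in \<open>auto simp: less_Suc_eq\<close>)
  have 2: "pivot (i + 2) f =
      (\<Sum>k<n. (\<Prod>j = i + 2..<i + 2 + 2 * k. gen j) * gpartial (i + 2 + 2 * k) f)"
    by (rule pivot_eq_sum) (use n in auto)
  have 3: "(\<Prod>j = i..<i + 2 * Suc k. gen j) =
      gen i * gen (i + 1) * (\<Prod>j = i + 2..<i + 2 + 2 * k. (gen j :: 'a grassmann))" for k
    by (simp add: prod.atLeast_Suc_lessThan mult.assoc)
  show ?thesis
    unfolding 1 2 sum.lessThan_Suc_shift 3 by (simp add: sum_distrib_left mult.assoc)
qed


section \<open>The Lie algebra generated by the first two pivot elements\<close>

text \<open>
  Elements of \<open>End \<Lambda>\<close> are functions; sums of functions are pointwise, and the associative product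
  is composition (not the pointwise product \<open>*\<close> of functions).
\<close>

definition escale :: "'k::field \<Rightarrow> ('k grassmann \<Rightarrow> 'k grassmann) \<Rightarrow> ('k grassmann \<Rightarrow> 'k grassmann)"
  where "escale c a = (\<lambda>f. gscale c (a f))"

global_interpretation endo: vector_space
  "escale :: 'k::field \<Rightarrow> ('k grassmann \<Rightarrow> 'k grassmann) \<Rightarrow> ('k grassmann \<Rightarrow> 'k grassmann)"
  by standard (simp_all add: escale_def fun_eq_iff grass.scale_right_distrib grass.scale_left_distrib)

definition endomorphisms :: "('k::field grassmann \<Rightarrow> 'k grassmann) set"
  where "endomorphisms = {a. Vector_Spaces.linear gscale gscale a}"

text \<open>In characteristic 2 the commutator \<open>ab - ba\<close> is \<open>ab + ba\<close>.\<close>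

definition bracket :: "('k::field grassmann \<Rightarrow> 'k grassmann) \<Rightarrow> ('k grassmann \<Rightarrow> 'k grassmann)
    \<Rightarrow> ('k grassmann \<Rightarrow> 'k grassmann)"
  where "bracket a b = (a \<circ> b) + (b \<circ> a)"

definition lie_subalgebra :: "('k::field grassmann \<Rightarrow> 'k grassmann) set \<Rightarrow> bool"
  where "lie_subalgebra W \<longleftrightarrow>
    endo.subspace W \<and> W \<subseteq> endomorphisms \<and> (\<forall>a\<in>W. \<forall>b\<in>W. bracket a b \<in> W)"

definition lieR :: "('k::field grassmann \<Rightarrow> 'k grassmann) set"
  where "lieR = lie_subalgebra hull {pivot 0, pivot 1}"

lemma endomorphisms_iff:
  "a \<in> endomorphisms \<longleftrightarrow>
    (\<forall>f g. a (f + g) = a f + a g) \<and> (\<forall>c f. a (gscale c f) = gscale c (a f))"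
  unfolding endomorphisms_def mem_Collect_eq module_hom_iff_linear[symmetric] module_hom_iff
  by (simp add: grass.module_axioms)

lemma pivot_endomorphism: "pivot i \<in> endomorphisms"
  unfolding endomorphisms_iff
proof safe
  interpret P: Vector_Spaces.linear gscale gscale "gpartial j :: 'a grassmann \<Rightarrow> _" for j
    by (rule gpartial_linear)
  fix f g :: "'a grassmann" and c
  let ?A = "\<lambda>f. {k. gpartial (i + 2 * k) f \<noteq> (0 :: 'a grassmann)}"
  let ?p = "\<lambda>k. \<Prod>j = i..<i + 2 * k. (gen j :: 'a grassmann)"
  define B where "B = ?A f \<union> ?A g \<union> ?A (f + g) \<union> ?A (gscale c f)"
  have "finite B" by (simp only: B_def finite_Un finite_gpartial_support)
  note e = pivot_eq_sum[OF this]
  have f: "pivot i f = (\<Sum>k\<in>B. ?p k * gpartial (i + 2 * k) f)"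
    by (rule e) (unfold B_def, blast)
  have g: "pivot i g = (\<Sum>k\<in>B. ?p k * gpartial (i + 2 * k) g)"
    by (rule e) (unfold B_def, blast)
  have fg: "pivot i (f + g) = (\<Sum>k\<in>B. ?p k * gpartial (i + 2 * k) (f + g))"
    by (rule e) (unfold B_def, blast)
  have cf: "pivot i (gscale c f) = (\<Sum>k\<in>B. ?p k * gpartial (i + 2 * k) (gscale c f))"
    by (rule e) (unfold B_def, blast)
  show "pivot i (f + g) = pivot i f + pivot i g"
    unfolding f g fg by (simp only: P.add distrib_left sum.distrib)
  show "pivot i (gscale c f) = gscale c (pivot i f)"
    unfolding f cf by (simp only: P.scale gscale_mult(2)[symmetric] grass.scale_sum_right)
qed

lemma lie_subalgebra_endomorphisms: "lie_subalgebra endomorphisms"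
  unfolding lie_subalgebra_def endo.subspace_def
  by (auto simp: endomorphisms_iff bracket_def escale_def grass.scale_right_distrib
      grass.scale_left_commute)

lemma lie_subalgebra_lieR: "lie_subalgebra lieR"
proof -
  let ?C = "{W :: ('a grassmann \<Rightarrow> 'a grassmann) set. lie_subalgebra W \<and> {pivot 0, pivot 1} \<subseteq> W}"
  have "endomorphisms \<in> ?C"
    using lie_subalgebra_endomorphisms pivot_endomorphism by blast
  then have "\<Inter>?C \<subseteq> endomorphisms" by (rule Inter_lower)
  moreover have "endo.subspace (\<Inter>?C)"
    by (rule endo.subspace_Inter) (simp add: lie_subalgebra_def)
  moreover have "bracket a b \<in> \<Inter>?C" if "a \<in> \<Inter>?C" "b \<in> \<Inter>?C" for a b
    using that by (simp add: lie_subalgebra_def)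
  ultimately show ?thesis unfolding lieR_def hull_def lie_subalgebra_def by blast
qed

text \<open>\<open>lie_commutator n a\<close>: \<open>a\<close> is a commutator of length \<open>n\<close>, with any arrangement of brackets.\<close>

inductive lie_commutator :: "nat \<Rightarrow> ('k::field grassmann \<Rightarrow> 'k grassmann) \<Rightarrow> bool" where
  gen0: "lie_commutator 1 (pivot 0)"
| gen1: "lie_commutator 1 (pivot 1)"
| comm: "lie_commutator m a \<Longrightarrow> lie_commutator n b \<Longrightarrow> lie_commutator (m + n) (bracket a b)"

definition lieR_component :: "nat \<Rightarrow> ('k::field grassmann \<Rightarrow> 'k grassmann) set"
  where "lieR_component n = endo.span {a. lie_commutator n a}"

text \<open>The series starts at index 1; the value at 0 is a dummy.\<close>

fun lieR_lower_central :: "nat \<Rightarrow> ('k::field grassmann \<Rightarrow> 'k grassmann) set" where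
  "lieR_lower_central 0 = lieR"
| "lieR_lower_central (Suc 0) = lieR"
| "lieR_lower_central (Suc (Suc n)) =
    endo.span {bracket a b | a b. a \<in> lieR \<and> b \<in> lieR_lower_central (Suc n)}"

text \<open>
  \<open>quotient_dim V W d\<close> says that \<open>V/W\<close> has dimension \<open>d\<close>: there are \<open>d\<close> elements of \<open>V\<close> whose cosets
  form a basis of the quotient space. Unlike for \<open>endo.dim\<close>, this fails for every \<open>d\<close> if \<open>V/W\<close> has
  infinite dimension.
\<close>

definition quotient_dim ::
    "('k::field grassmann \<Rightarrow> 'k grassmann) set \<Rightarrow> ('k grassmann \<Rightarrow> 'k grassmann) set \<Rightarrow> nat \<Rightarrow> bool"
  where "quotient_dim V W d \<longleftrightarrow>
    W \<subseteq> V \<and>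
    (\<exists>B. finite B \<and> card B = d \<and> B \<subseteq> V \<and>
      (\<forall>u. (\<Sum>b\<in>B. escale (u b) b) \<in> W \<longrightarrow> (\<forall>b\<in>B. u b = 0)) \<and>
      (\<forall>x\<in>V. \<exists>u. x - (\<Sum>b\<in>B. escale (u b) b) \<in> W))"

end

theory Submission
  imports Defs
begin

text \<open>
  Call \<open>x\<^sub>S v\<^sub>m\<close> with \<open>S \<subseteq> {0, \<dots>, m - 2}\<close> a standard monomial. Since \<open>[v\<^sub>i, v\<^sub>i\<^sub>+\<^sub>1] = x\<^sub>i v\<^sub>i\<^sub>+\<^sub>2\<close> and
  \<open>[v\<^sub>i, v\<^sub>i\<^sub>+\<^sub>2] = 0\<close>, the span of the standard monomials is closed under brackets, and each of
  them is itself a commutator: bracketing \<open>x\<^sub>U v\<^sub>m\<close> with \<open>v\<^bsub>m-1\<^esub>\<close> gives \<open>x\<^sub>U x\<^bsub>m-1\<^esub> v\<^bsub>m+1\<^esub>\<close>, and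
  bracketing once more with \<open>v\<^bsub>m-1\<^esub>\<close> removes \<open>x\<^bsub>m-1\<^esub>\<close>. So they form a homogeneous basis of the
  Lie algebra. The monomial \<open>x\<^sub>S v\<^sub>m\<close> has degree \<open>w\<^sub>m - \<Sum>\<^sub>i\<^sub>\<in>\<^sub>S w\<^sub>i\<close> with \<open>w = 1, 1, 3, 5, 11, 21, \<dots>\<close>,
  whence \<open>a\<^sub>n\<close> counts subset sums of these weights. As \<open>\<Sum>\<^sub>i\<^sub><\<^sub>m w\<^sub>i\<close> is \<open>w\<^sub>m\<close> or \<open>w\<^sub>m - 1\<close>
  according to the parity of \<open>m\<close>, the subset-sum sequence for \<open>m + 1\<close> consists of two copies of
  that for \<open>m\<close>, which are adjacent or overlap in one entry. The blocks are read off from this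
  self-similarity, and the two different ways in which copies continue exclude periodicity.
\<close>

section \<open>Commutators of pivot elements\<close>


lemma grassmann_double:
  fixes f :: "'k::comm_ring_1 grassmann"
  assumes "CHAR('k) = 2"
  shows "f + f = 0"
  by (rule grassmann_eqI) (simp only: gcoeff_simps char2_double[OF assms])

lemma pivot_add: "pivot i (f + g) = pivot i f + pivot i (g :: 'k::field grassmann)"
  using pivot_endomorphism[of i] unfolding endomorphisms_iff by blast

lemma pivot_scale: "pivot i (gscale c f) = gscale c (pivot i (f :: 'k::field grassmann))"
  using pivot_endomorphism[of i] unfolding endomorphisms_iff by blast

lemma pivot_mult:
  fixes f g :: "'k::comm_ring_1 grassmann"
  assumes "CHAR('k) = 2"
  shows "pivot i (f * g) = pivot i f * g + f * pivot i g"
proof -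
  \<comment> \<open>The sum in \<open>pivot\<close> ranges over a support that depends on its
    argument. One finite set covering all three supports makes the sums comparable termwise.\<close>
  define B where "B = {k. gpartial (i + 2 * k) f \<noteq> 0} \<union> {k. gpartial (i + 2 * k) g \<noteq> 0} \<union>
    {k. gpartial (i + 2 * k) (f * g) \<noteq> 0}"
  have "finite B" by (simp only: B_def finite_Un finite_gpartial_support)
  note e = pivot_eq_sum[OF this]
  have f: "pivot i f = (\<Sum>k\<in>B. (\<Prod>j = i..<i + 2 * k. gen j) * gpartial (i + 2 * k) f)"
    by (rule e) (unfold B_def, blast)
  have g: "pivot i g = (\<Sum>k\<in>B. (\<Prod>j = i..<i + 2 * k. gen j) * gpartial (i + 2 * k) g)"
    by (rule e) (unfold B_def, blast)
  have fg: "pivot i (f * g) = (\<Sum>k\<in>B. (\<Prod>j = i..<i + 2 * k. gen j) * gpartial (i + 2 * k) (f * g))"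
    by (rule e) (unfold B_def, blast)
  show ?thesis
    unfolding f g fg gpartial_mult[OF assms] sum_distrib_left sum_distrib_right sum.distrib[symmetric]
    by (intro sum.cong refl) (simp only: distrib_left mult_ac)
qed

lemma gpartial_commute: "gpartial i (gpartial j f) = gpartial j (gpartial i f)"
  by (rule grassmann_eqI) (auto simp: gpartial.rep_eq insert_commute)

lemma gpartial_gmonom: "i \<notin> S \<Longrightarrow> gpartial i (gmonom S) = 0"
  by (rule grassmann_eqI) (auto simp: gpartial.rep_eq gmonom.rep_eq)

lemma gpartial_zero [simp]: "gpartial i 0 = 0"
  by (rule grassmann_eqI) (simp add: gpartial.rep_eq)

text \<open>The coefficients in the expansion of v_j only involve letters of index at least j, hence
  above i, so \<open>gpartial i\<close> passes through them.\<close>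

lemma gpartial_pivot_commute:
  fixes f :: "'k::field grassmann"
  assumes char2: "CHAR('k) = 2" and "i < j"
  shows "gpartial i (pivot j f) = pivot j (gpartial i f)"
proof -
  interpret P: Vector_Spaces.linear gscale gscale "gpartial i :: 'k grassmann \<Rightarrow> _"
    by (rule gpartial_linear)
  let ?A = "{k. gpartial (j + 2 * k) f \<noteq> 0}"
  have fin: "finite ?A" by (rule finite_gpartial_support)
  have "gpartial i (\<Prod>l = j..<j + 2 * k. gen l) = (0 :: 'k grassmann)" for k
    using \<open>i < j\<close> by (subst prod_gen) (auto intro: gpartial_gmonom)
  then have "gpartial i (pivot j f) =
      (\<Sum>k\<in>?A. (\<Prod>l = j..<j + 2 * k. gen l) * gpartial (j + 2 * k) (gpartial i f))"
    unfolding pivot_def P.sum gpartial_mult[OF char2]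
    by (simp add: gpartial_commute)
  also have "\<dots> = pivot j (gpartial i f)"
  proof (rule pivot_eq_sum[symmetric, OF fin], rule subsetI)
    fix k assume "k \<in> {k. gpartial (j + 2 * k) (gpartial i f) \<noteq> 0}"
    then have "gpartial i (gpartial (j + 2 * k) f) \<noteq> 0"
      by (simp only: gpartial_commute mem_Collect_eq not_False_eq_True)
    then show "k \<in> ?A" by auto
  qed
  finally show ?thesis .
qed

text \<open>\<open>wt i\<close> is the degree of \<open>v\<^sub>i\<close>; the letter \<open>x\<^sub>i\<close> has degree \<open>- wt i\<close>.\<close>

fun wt :: "nat \<Rightarrow> nat" where
  "wt 0 = 1"
| "wt (Suc 0) = 1"
| "wt (Suc (Suc n)) = wt (Suc n) + 2 * wt n"

section \<open>Weights and homogeneous elements\<close>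

text \<open>The weights are the Jacobsthal numbers: each is twice its predecessor up to 1, with
  alternating sign. The corrections are added on both sides because subtraction of naturals
  truncates.\<close>

lemma wt_Suc: "wt (Suc n) + (if even n then 1 else 0) = 2 * wt n + (if odd n then 1 else 0)"
  by (induction n rule: wt.induct) auto

lemma sum_wt: "sum wt {..<n} + (if even n then 1 else 0) = wt n"
proof (induction n)
  case (Suc n)
  then show ?case using wt_Suc[of n] by (auto split: if_splits)
qed simp

lemma wt_pos: "0 < wt n"
  by (induction n rule: wt.induct) auto

lemma wt_le_Suc: "wt n \<le> wt (Suc n)"
  using wt_Suc[of n] wt_pos[of n] by (auto split: if_splits)

text \<open>The degree is an integer because pivots lower it.\<close>

definition homog :: "int \<Rightarrow> nat \<Rightarrow> 'k::comm_ring_1 grassmann set"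
  where "homog d k = {f. \<forall>U. gcoeff f U \<noteq> 0 \<longrightarrow> U \<subseteq> {..<k} \<and> int (sum wt U) = d}"

lemma homogI: "(\<And>U. finite U \<Longrightarrow> gcoeff f U \<noteq> 0 \<Longrightarrow> U \<subseteq> {..<k} \<and> int (sum wt U) = d) \<Longrightarrow> f \<in> homog d k"
  using gcoeff_infinite unfolding homog_def by blast

lemma homog_zero: "0 \<in> homog d k"
  by (simp add: homog_def)

lemma homog_add: "f \<in> homog d k \<Longrightarrow> g \<in> homog d k \<Longrightarrow> f + g \<in> homog d k"
proof (rule homogI)
  fix U assume fg: "f \<in> homog d k" "g \<in> homog d k" and "gcoeff (f + g) U \<noteq> 0"
  then have "gcoeff f U \<noteq> 0 \<or> gcoeff g U \<noteq> 0" by auto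
  then show "U \<subseteq> {..<k} \<and> int (sum wt U) = d" using fg unfolding homog_def by blast
qed

lemma homog_gmonom: "S \<subseteq> {..<k} \<Longrightarrow> gmonom S \<in> homog (int (sum wt S)) k"
  by (auto simp: homog_def gmonom.rep_eq)

lemma homog_gen: "i < k \<Longrightarrow> gen i \<in> homog (int (wt i)) k"
  using homog_gmonom[of "{i}" k] by (simp add: gen_def)

lemma homog_mono: "f \<in> homog d k \<Longrightarrow> k \<le> k' \<Longrightarrow> f \<in> homog d k'"
  by (fastforce simp: homog_def)

lemma homog_mult:
  assumes f: "f \<in> homog d k" and g: "g \<in> homog e k"
  shows "f * g \<in> homog (d + e) k"
proof (rule homogI)
  fix U assume U: "finite U" "gcoeff (f * g) U \<noteq> 0"
  then have "(\<Sum>T\<in>Pow U. gcoeff f T * gcoeff g (U - T)) \<noteq> 0"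
    by (simp add: times_grassmann.rep_eq)
  then obtain T where T: "T \<in> Pow U" "gcoeff f T * gcoeff g (U - T) \<noteq> 0"
    by (rule sum.not_neutral_contains_not_neutral)
  then have "gcoeff f T \<noteq> 0" "gcoeff g (U - T) \<noteq> 0" by auto
  then have "T \<subseteq> {..<k}" "int (sum wt T) = d" "U - T \<subseteq> {..<k}" "int (sum wt (U - T)) = e"
    using f g unfolding homog_def by auto
  moreover have "sum wt U = sum wt (U - T) + sum wt T"
    using T U by (intro sum.subset_diff) auto
  ultimately show "U \<subseteq> {..<k} \<and> int (sum wt U) = d + e" by auto
qed

lemma homog_gpartial:
  assumes f: "f \<in> homog d k"
  shows "gpartial i f \<in> homog (d - int (wt i)) k"
proof (rule homogI)
  fix U assume U: "finite U" "gcoeff (gpartial i f) U \<noteq> 0"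
  then have "i \<notin> U" "gcoeff f (insert i U) \<noteq> 0"
    by (auto simp: gpartial.rep_eq split: if_splits)
  moreover from this have "insert i U \<subseteq> {..<k}" "int (sum wt (insert i U)) = d"
    using f unfolding homog_def by auto
  ultimately show "U \<subseteq> {..<k} \<and> int (sum wt U) = d - int (wt i)"
    using U by simp
qed

lemma gpartial_homog_eq_0:
  assumes "f \<in> homog d k" "k \<le> i"
  shows "gpartial i f = 0"
  by (rule grassmann_eqI) (use assms in \<open>fastforce simp: homog_def gpartial.rep_eq\<close>)

lemma pivot_homog_eq_0:
  assumes "f \<in> homog d k" "k \<le> i"
  shows "pivot i f = 0"
  using gpartial_homog_eq_0[OF assms(1)] assms(2) by (simp add: pivot_def)

text \<open>Both summands of v_i lower the degree by \<open>wt i\<close>, since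
  \<open>wt (i + 2) = wt (i + 1) + 2 * wt i\<close>; this is what dictates the weights. The
  induction moves i up to k, from where on pivots vanish on f.\<close>

lemma homog_pivot:
  fixes f :: "'k::comm_ring_1 grassmann"
  assumes f: "f \<in> homog d k"
  shows "pivot i f \<in> homog (d - int (wt i)) k"
proof (induction "k - i" arbitrary: i rule: less_induct)
  case less
  consider "k \<le> i" | "k = Suc i" | "Suc i < k" by linarith
  then show ?case
  proof cases
    case 1
    then show ?thesis by (simp add: pivot_homog_eq_0[OF f] homog_zero)
  next
    case 2
    \<comment> \<open>Here x_(i+1) is outside the allowed letters, so the second summand must vanish
      altogether.\<close>
    then have "pivot i f = gpartial i f"
      using pivot_homog_eq_0[OF f, of "i + 2"] by (simp add: pivot_rec[of i])
    then show ?thesis by (simp add: homog_gpartial[OF f])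
  next
    case 3
    then have "pivot (i + 2) f \<in> homog (d - int (wt (i + 2))) k"
      by (intro less) simp
    then have "gen i * gen (i + 1) * pivot (i + 2) f \<in>
        homog (int (wt i) + int (wt (i + 1)) + (d - int (wt (i + 2)))) k"
      using 3 by (intro homog_mult homog_gen) auto
    then have "gen i * gen (i + 1) * pivot (i + 2) f \<in> homog (d - int (wt i)) k"
      by (simp add: algebra_simps)
    then show ?thesis
      using homog_gpartial[OF f, of i] by (simp add: pivot_rec[of i] homog_add)
  qed
qed

section \<open>Values of pivots on letters, and commutators of two pivots\<close>

lemma pivot_gen_less:
  assumes "j < i"
  shows "pivot i (gen j) = 0"
  using assms by (intro pivot_homog_eq_0[OF homog_gen[of j "Suc j"]]) auto

lemma pivot_gen_same: "pivot i (gen i) = 1"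
  by (simp add: pivot_rec[of i] gpartial_gen pivot_gen_less)

text \<open>The value is x_i ... x_(j-1) for even j - i and 0 for odd j - i. Only divisibility by
  x_(j-1) is kept: standard monomials with pivot v_j lack this letter, which later yields dual
  functionals.\<close>

lemma pivot_gen_greater: "i < j \<Longrightarrow> \<exists>g. pivot i (gen j) = gen (j - 1) * g"
proof (induction "j - i" arbitrary: i rule: less_induct)
  case less
  then consider "j = i + 1" | "j = i + 2" | "i + 2 < j" by linarith
  then show ?case
  proof cases
    case 1
    then have "pivot i (gen j) = gen (j - 1) * 0"
      by (simp add: pivot_rec[of i] gpartial_gen pivot_gen_less)
    then show ?thesis ..
  next
    case 2
    then have "pivot i (gen j) = gen (j - 1) * gen i"
      by (simp add: pivot_rec[of i] gpartial_gen pivot_gen_same mult.commute)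
    then show ?thesis ..
  next
    case 3
    then have "j - (i + 2) < j - i" by simp
    from less(1)[OF this 3] obtain g where "pivot (i + 2) (gen j) = (gen (j - 1) * g :: 'a grassmann)"
      by blast
    then have "pivot i (gen j) = gen (j - 1) * (gen i * gen (i + 1) * g)"
      using less.prems by (simp add: pivot_rec[of i] gpartial_gen mult.left_commute mult.assoc)
    then show ?thesis ..
  qed
qed


text \<open>Only v_i is unfolded. Its part \<open>gpartial i\<close> commutes with v_j, and v_j
  kills x_i, so the Leibniz rule leaves a single extra term, the one with v_j(x_(i+1)).\<close>

lemma pivot_commutator_rec:
  fixes f :: "'k::field grassmann"
  assumes char2: "CHAR('k) = 2" and "i < j"
  shows "pivot i (pivot j f) + pivot j (pivot i f) =
    gen i * gen (i + 1) * (pivot (i + 2) (pivot j f) + pivot j (pivot (i + 2) f)) +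
    gen i * pivot j (gen (i + 1)) * pivot (i + 2) f"
proof -
  have 1: "gpartial i (pivot j f) + pivot j (gpartial i f) = 0"
    by (simp only: gpartial_pivot_commute[OF assms] grassmann_double[OF char2])
  have 2: "pivot i (pivot j f) = gpartial i (pivot j f) + gen i * gen (i + 1) * pivot (i + 2) (pivot j f)"
    by (rule pivot_rec)
  have 3: "pivot j (pivot i f) = pivot j (gpartial i f) +
      (gen i * pivot j (gen (i + 1)) * pivot (i + 2) f + gen i * gen (i + 1) * pivot j (pivot (i + 2) f))"
    unfolding pivot_rec[of i f] pivot_add pivot_mult[OF char2] pivot_gen_less[OF \<open>i < j\<close>] by simp
  have "pivot i (pivot j f) + pivot j (pivot i f) = (gpartial i (pivot j f) + pivot j (gpartial i f)) +
      (gen i * gen (i + 1) * pivot (i + 2) (pivot j f) + gen i * gen (i + 1) * pivot j (pivot (i + 2) f)) +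
      gen i * pivot j (gen (i + 1)) * pivot (i + 2) f"
    unfolding 2 3 by (simp only: add_ac)
  then show ?thesis unfolding 1 by (simp only: distrib_left add_0)
qed

text \<open>By the recursion at i + 1, the inner commutator of v_(i+1) and v_(i+2) is a multiple of
  x_(i+1), so the factor x_i x_(i+1) in front annihilates it.\<close>

lemma pivot_commutator_Suc:
  fixes f :: "'k::field grassmann"
  assumes char2: "CHAR('k) = 2"
  shows "pivot i (pivot (i + 1) f) + pivot (i + 1) (pivot i f) = gen i * pivot (i + 2) f"
proof -
  have rec: "pivot i (pivot (i + 1) f) + pivot (i + 1) (pivot i f) =
      gen i * gen (i + 1) * (pivot (i + 1) (pivot (i + 2) f) + pivot (i + 2) (pivot (i + 1) f)) +
      gen i * pivot (i + 2) f" for i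
    using pivot_commutator_rec[OF char2, of i "i + 1" f] by (simp add: pivot_gen_same add.commute)
  have sq: "gen (i + 1) * gen (i + 1) = (0 :: 'k grassmann)" by (rule gen_square)
  have "gen (i + 1) * (pivot (i + 1) (pivot (i + 2) f) + pivot (i + 2) (pivot (i + 1) f)) = 0"
    using rec[of "i + 1"] sq by (simp add: distrib_left mult.assoc[symmetric])
  then show ?thesis unfolding rec[of i] by (simp add: mult.assoc)
qed

lemma pivot_commutator_add_2:
  fixes f :: "'k::field grassmann"
  assumes char2: "CHAR('k) = 2"
  shows "pivot i (pivot (i + 2) f) + pivot (i + 2) (pivot i f) = 0"
  using pivot_commutator_rec[OF char2, of i "i + 2" f]
  by (simp add: pivot_gen_less grassmann_double[OF char2])

text \<open>Steps of two reduce to the distances 1 and 2, which gives p = x_i ... x_(j-1) for odd j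
  - i and p = 0 otherwise. Closure under brackets needs only the degree of p and the range of its
  letters.\<close>

lemma pivot_commutator:
  assumes char2: "CHAR('k::field) = 2" and "i < j"
  shows "\<exists>p. p \<in> homog (int (wt (j + 1)) - int (wt i) - int (wt j)) j \<and>
    (\<forall>f :: 'k grassmann. pivot i (pivot j f) + pivot j (pivot i f) = p * pivot (j + 1) f)"
  using \<open>i < j\<close>
proof (induction "j - i" arbitrary: i rule: less_induct)
  case less
  then consider "j = i + 1" | "j = i + 2" | "i + 2 < j" by linarith
  then show ?case
  proof cases
    case 1
    have "gen i \<in> homog (int (wt i)) j" by (rule homog_gen) (use 1 in simp)
    then show ?thesis
      using pivot_commutator_Suc[OF char2, of i] 1 by (intro exI[of _ "gen i"]) simp
  next
    case 2
    then show ?thesis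
      using pivot_commutator_add_2[OF char2, of i] by (intro exI[of _ 0]) (auto simp: homog_zero)
  next
    case 3
    then have "j - (i + 2) < j - i" by simp
    from less(1)[OF this 3] obtain p where
      p: "p \<in> homog (int (wt (j + 1)) - int (wt (i + 2)) - int (wt j)) j"
      "\<And>f :: 'k grassmann. pivot (i + 2) (pivot j f) + pivot j (pivot (i + 2) f) = p * pivot (j + 1) f"
      by blast
    have "gen i * gen (i + 1) * p \<in>
        homog (int (wt i) + int (wt (i + 1)) + (int (wt (j + 1)) - int (wt (i + 2)) - int (wt j))) j"
      using 3 p by (intro homog_mult homog_gen) auto
    then have "gen i * gen (i + 1) * p \<in> homog (int (wt (j + 1)) - int (wt i) - int (wt j)) j"
      by (simp add: algebra_simps)
    moreover have "pivot i (pivot j f) + pivot j (pivot i f) = gen i * gen (i + 1) * p * pivot (j + 1) f"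
      for f :: "'k grassmann"
      using pivot_commutator_rec[OF char2 less(2), of f] p(2)[of f] 3
      by (simp add: pivot_gen_less mult.assoc)
    ultimately show ?thesis by blast
  qed
qed

section \<open>Standard monomials\<close>

lemma sum_apply: "sum h A x = (\<Sum>a\<in>A. h a x)"
  by (induction A rule: infinite_finite_induct) simp_all

definition gder :: "'k::comm_ring_1 grassmann \<Rightarrow> nat \<Rightarrow> 'k grassmann \<Rightarrow> 'k grassmann"
  where "gder f m = (\<lambda>h. f * pivot m h)"

lemma gder_endomorphism: "gder f m \<in> endomorphisms"
  by (simp add: endomorphisms_iff gder_def pivot_add pivot_scale gscale_mult(2) distrib_left)

lemma bracket_gder:
  fixes f g :: "'k::field grassmann"
  assumes "CHAR('k) = 2"
  shows "bracket (gder f m) (gder g n) = gder (f * pivot m g) n + gder (g * pivot n f) m +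
    (\<lambda>h. f * g * (pivot m (pivot n h) + pivot n (pivot m h)))"
  by (rule ext) (simp add: bracket_def gder_def pivot_mult[OF assms] algebra_simps)

lemma bracket_commute: "bracket a b = bracket b a"
  by (simp add: bracket_def add.commute)

lemma bracket_add_left:
  "b \<in> endomorphisms \<Longrightarrow> bracket (x + y) b = bracket x b + bracket y b"
  by (rule ext) (simp add: bracket_def endomorphisms_iff)

lemma bracket_scale_left:
  "b \<in> endomorphisms \<Longrightarrow> bracket (escale c x) b = escale c (bracket x b)"
  by (rule ext) (simp add: bracket_def endomorphisms_iff escale_def grass.scale_right_distrib)

lemma bracket_zero_left: "b \<in> endomorphisms \<Longrightarrow> bracket 0 b = 0"
  using bracket_scale_left[of b 0 0] by simp

lemma subspace_endomorphisms: "endo.subspace endomorphisms"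
  using lie_subalgebra_endomorphisms unfolding lie_subalgebra_def by blast

text \<open>Composition is additive in its outer factor for arbitrary functions, but in its inner
  factor only if the outer one is; hence the condition that b is linear.\<close>

lemma bracket_span_left:
  assumes a: "a \<in> endo.span A" and b: "b \<in> endomorphisms"
    and AC: "\<And>x. x \<in> A \<Longrightarrow> bracket x b \<in> endo.span C"
  shows "bracket a b \<in> endo.span C"
proof -
  have "endo.subspace {x. bracket x b \<in> endo.span C}"
    unfolding endo.subspace_def
    by (auto simp: b bracket_add_left bracket_scale_left bracket_zero_left
        endo.span_zero endo.span_add endo.span_scale)
  then show ?thesis using endo.span_induct[OF a] AC by blast
qed

lemma bracket_span:
  assumes a: "a \<in> endo.span A" and b: "b \<in> endo.span B"
    and endo: "A \<subseteq> endomorphisms" "B \<subseteq> endomorphisms"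
    and AB: "\<And>x y. x \<in> A \<Longrightarrow> y \<in> B \<Longrightarrow> bracket x y \<in> endo.span C"
  shows "bracket a b \<in> endo.span C"
proof (rule bracket_span_left[OF a])
  show "b \<in> endomorphisms"
    using b endo(2) subspace_endomorphisms endo.span_minimal by blast
  show "bracket x b \<in> endo.span C" if "x \<in> A" for x
    unfolding bracket_commute[of x]
    by (rule bracket_span_left[OF b]) (use that endo(1) in blast, metis that AB bracket_commute)
qed

text \<open>\<open>Std n\<close> indexes the standard monomials \<open>x\<^sub>S v\<^sub>m\<close> of degree \<open>n\<close>. In \<open>m - 1\<close> the
  truncation at \<open>m = 0\<close> is intended: \<open>v\<^sub>0\<close> and \<open>v\<^sub>1\<close> carry no letters.\<close>

definition Std :: "nat \<Rightarrow> (nat \<times> nat set) set"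
  where "Std n = {(m, S). S \<subseteq> {..<m - 1} \<and> wt m = n + sum wt S}"

definition std_der :: "nat \<times> nat set \<Rightarrow> 'k::comm_ring_1 grassmann \<Rightarrow> 'k grassmann"
  where "std_der = (\<lambda>(m, S). gder (gmonom S) m)"

abbreviation std_ders :: "nat \<Rightarrow> ('k::comm_ring_1 grassmann \<Rightarrow> 'k grassmann) set"
  where "std_ders n \<equiv> std_der ` Std n"

lemma std_ders_endomorphisms: "std_ders n \<subseteq> endomorphisms"
  by (auto simp: std_der_def gder_endomorphism)

lemma gder_in_span:
  fixes f :: "'k::field grassmann"
  assumes f: "f \<in> homog d (m - 1)" and d: "int (wt m) = int n + d"
  shows "gder f m \<in> endo.span (std_ders n)"
proof -
  let ?A = "{U. gcoeff f U \<noteq> 0}"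
  have "gder f m = gder (\<Sum>U\<in>?A. gscale (gcoeff f U) (gmonom U)) m"
    using grassmann_expand[of f] by (rule arg_cong)
  also have "\<dots> = (\<Sum>U\<in>?A. escale (gcoeff f U) (gder (gmonom U) m))"
    by (rule ext) (simp add: gder_def sum_distrib_right gscale_mult(1) escale_def sum_apply)
  also have "\<dots> \<in> endo.span (std_ders n)"
  proof (intro endo.span_sum endo.span_scale endo.span_base)
    fix U assume "U \<in> ?A"
    then have "U \<subseteq> {..<m - 1}" "int (sum wt U) = d" using f unfolding homog_def by blast+
    moreover from this have "wt m = n + sum wt U" using d by linarith
    ultimately have "(m, U) \<in> Std n" by (simp add: Std_def)
    then show "gder (gmonom U) m \<in> std_ders n" by (force simp: std_der_def)
  qed
  finally show ?thesis .
qed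

text \<open>By symmetry let m <= n. The bracket of x_S v_m and x_T v_n is x_S v_m(x_T) v_n plus x_S
  x_T p v_(n+1). The letters of p lie below n, exactly the range that v_(n+1) admits.\<close>

lemma bracket_std_ders:
  fixes a b :: "'k::field grassmann \<Rightarrow> 'k grassmann"
  assumes char2: "CHAR('k) = 2" and "a \<in> std_ders i" "b \<in> std_ders j"
  shows "bracket a b \<in> endo.span (std_ders (i + j))"
proof -
  have main: "bracket (std_der (m, S)) (std_der (n, T)) \<in> endo.span (std_ders (i + j) :: ('k grassmann \<Rightarrow> _) set)"
    if S: "(m, S) \<in> Std i" and T: "(n, T) \<in> Std j" and "m \<le> n" for i j m n S T
  proof -
    let ?f = "gmonom S :: 'k grassmann" and ?g = "gmonom T :: 'k grassmann"
    let ?c = "\<lambda>h :: 'k grassmann. ?f * ?g * (pivot m (pivot n h) + pivot n (pivot m h))"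
    define d e where "d = int (sum wt S)" and "e = int (sum wt T)"
    have f: "?f \<in> homog d (m - 1)" and g: "?g \<in> homog e (n - 1)"
      using S T homog_gmonom[of S "m - 1"] homog_gmonom[of T "n - 1"]
      unfolding Std_def d_def e_def by blast+
    have f': "?f \<in> homog d (n - 1)" by (rule homog_mono[OF f]) (use \<open>m \<le> n\<close> in simp)
    have w: "int (wt m) = int i + d" "int (wt n) = int j + e"
      using S T by (auto simp: Std_def d_def e_def)
    have 1: "gder (?f * pivot m ?g) n \<in> endo.span (std_ders (i + j))"
      by (rule gder_in_span[OF homog_mult[OF f' homog_pivot[OF g]]]) (use w in simp)
    \<comment> \<open>The letters of x_S lie below m - 1, hence below n.\<close>
    have "pivot n ?f = 0" by (rule pivot_homog_eq_0[OF f]) (use \<open>m \<le> n\<close> in simp)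
    then have 2: "gder (?g * pivot n ?f) m = 0" by (simp add: gder_def fun_eq_iff)
    have 3: "?c \<in> endo.span (std_ders (i + j))"
    proof (cases "m = n")
      case True
      then have "?c = 0" by (simp add: grassmann_double[OF char2] fun_eq_iff)
      then show ?thesis by (simp add: endo.span_zero)
    next
      case False
      then obtain p where p: "p \<in> homog (int (wt (n + 1)) - int (wt m) - int (wt n)) n"
        "\<And>h :: 'k grassmann. pivot m (pivot n h) + pivot n (pivot m h) = p * pivot (n + 1) h"
        using pivot_commutator[OF char2, of m n] \<open>m \<le> n\<close> by auto
      have fg: "?f * ?g \<in> homog (d + e) n"
        by (rule homog_mono[OF homog_mult[OF f' g]]) simp
      have "?c = gder (?f * ?g * p) (n + 1)"
        by (simp add: gder_def p(2) mult.assoc)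
      also have "\<dots> \<in> endo.span (std_ders (i + j))"
        by (rule gder_in_span) (use homog_mult[OF fg p(1)] w in auto)
      finally show ?thesis .
    qed
    have "std_der (m, S) = gder ?f m" "std_der (n, T) = gder ?g n" by (simp_all add: std_der_def)
    then show ?thesis
      by (simp only: bracket_gder[OF char2] 2 add_0_right endo.span_add[OF 1 3])
  qed
  obtain m S n T where "a = std_der (m, S)" "(m, S) \<in> Std i" "b = std_der (n, T)" "(n, T) \<in> Std j"
    using assms by auto
  then show ?thesis
    using main[of m S i n T j] main[of n T j m S i] bracket_commute[of a b]
    by (cases "m \<le> n") (auto simp: add.commute)
qed

lemma pivot_std_ders: "pivot 0 \<in> std_ders 1" "pivot 1 \<in> std_ders 1"
proof -
  have "(0, {}) \<in> Std 1" "(1, {}) \<in> Std 1" by (auto simp: Std_def)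
  moreover have "pivot m = std_der (m, {})" for m
    by (simp add: std_der_def gder_def gmonom_empty)
  ultimately show "pivot 0 \<in> std_ders 1" "pivot 1 \<in> std_ders 1" by blast+
qed

lemma lie_commutator_in_span:
  assumes char2: "CHAR('k::field) = 2" and "lie_commutator n a"
  shows "a \<in> endo.span (std_ders n :: ('k grassmann \<Rightarrow> _) set)"
  using assms(2)
proof induction
  case (comm m a n b)
  show ?case
    by (rule bracket_span[OF comm.IH std_ders_endomorphisms std_ders_endomorphisms])
      (rule bracket_std_ders[OF char2])
qed (rule endo.span_base, rule pivot_std_ders)+

text \<open>With m = k + 2, the letter x_k is the only one that v_m admits and v_(k+1) does not.
  Monomials containing x_k arise from v_(k+1) by a bracket with v_k, the others from these by a
  second such bracket.\<close>

lemma std_der_lie_commutator: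
  assumes char2: "CHAR('k::field) = 2" and "(m, S) \<in> Std n"
  shows "lie_commutator n (std_der (m, S) :: 'k grassmann \<Rightarrow> _)"
  using assms(2)
proof (induction m arbitrary: n S rule: less_induct)
  case (less m)
  have std_der_empty: "std_der (k, {}) = (pivot k :: 'k grassmann \<Rightarrow> _)" for k
    by (simp add: std_der_def gder_def gmonom_empty)
  consider "m = 0" | "m = 1" | k where "m = k + 2"
    by (metis One_nat_def add_2_eq_Suc' not0_implies_Suc)
  then show ?case
  proof cases
    case (3 k)
    have piv: "lie_commutator (wt k) (pivot k :: 'k grassmann \<Rightarrow> _)"
      using less(1)[of k "{}" "wt k"] 3 by (simp add: std_der_empty Std_def)
    have pivot_gmonom: "pivot k (gmonom U :: 'k grassmann) = 0" if "U \<subseteq> {..<k}" for U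
      by (rule pivot_homog_eq_0[OF homog_gmonom[OF that]]) simp
    have insert_gmonom: "gmonom (insert k U) = (gen k * gmonom U :: 'k grassmann)" if "U \<subseteq> {..<k}" for U
      using that finite_subset[OF that] by (subst gen_mult_gmonom) auto
    have sum_U: "sum wt U \<le> wt k" if "U \<subseteq> {..<k}" for U
      using sum_mono2[OF _ that, of wt] sum_wt[of k] by simp
    have with_gen: "lie_commutator n (std_der (m, insert k U) :: 'k grassmann \<Rightarrow> _)"
      if U: "U \<subseteq> {..<k}" and "(m, insert k U) \<in> Std n" for n U
    proof -
      have fin: "finite U" "k \<notin> U" using U finite_subset by auto
      have n: "wt (k + 1) + wt k = n + sum wt U" using that 3 fin by (simp add: Std_def)
      \<comment> \<open>The degree of x_U v_(k+1); by \<open>le\<close> below the subtraction does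
        not truncate.\<close>
      define n' where "n' = wt (k + 1) - sum wt U"
      have le: "sum wt U \<le> wt (k + 1)" using sum_U[OF U] wt_le_Suc[of k] by simp
      then have "lie_commutator n' (std_der (k + 1, U) :: 'k grassmann \<Rightarrow> _)"
        using less(1)[of "k + 1" U n'] 3 U by (simp add: n'_def Std_def)
      then have "lie_commutator (wt k + n') (bracket (pivot k) (std_der (k + 1, U)) :: 'k grassmann \<Rightarrow> _)"
        by (intro lie_commutator.comm piv)
      moreover have "bracket (pivot k) (std_der (k + 1, U)) = (std_der (m, insert k U) :: 'k grassmann \<Rightarrow> _)"
      proof
        fix h :: "'k grassmann"
        have "bracket (pivot k) (std_der (k + 1, U)) h =
            gmonom U * (pivot k (pivot (k + 1) h) + pivot (k + 1) (pivot k h))"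
          by (simp add: bracket_def std_der_def gder_def pivot_mult[OF char2] pivot_gmonom[OF U] distrib_left)
        then show "bracket (pivot k) (std_der (k + 1, U)) h = std_der (m, insert k U) h"
          unfolding pivot_commutator_Suc[OF char2]
          by (simp add: std_der_def gder_def insert_gmonom[OF U] 3 mult_ac)
      qed
      moreover have "wt k + n' = n"
        using n le by (simp add: n'_def)
      ultimately show ?thesis by simp
    qed
    show ?thesis
    proof (cases "k \<in> S")
      case True
      have "S - {k} \<subseteq> {..<k}" "insert k (S - {k}) = S"
        using less.prems 3 True by (auto simp: Std_def)
      then show ?thesis using with_gen[of "S - {k}" n] less.prems by simp
    next
      case False
      have "S \<subseteq> {..<k + 1}" using less.prems 3 by (simp add: Std_def)
      then have S: "S \<subseteq> {..<k}" using False less_Suc_eq by auto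
      then have fin: "finite S" using finite_subset by blast
      have n: "wt m = n + sum wt S" using less.prems by (simp add: Std_def)
      have le: "wt k \<le> n" using n 3 sum_U[OF S] wt_le_Suc[of k] by simp
      \<comment> \<open>Inserting x_k lowers the degree by \<open>wt k\<close>, which the bracket
        with \<open>pivot k\<close> restores.\<close>
      then have "(m, insert k S) \<in> Std (n - wt k)"
        using S n 3 False fin by (auto simp: Std_def)
      then have "lie_commutator (wt k + (n - wt k))
          (bracket (pivot k) (std_der (m, insert k S)) :: 'k grassmann \<Rightarrow> _)"
        by (intro lie_commutator.comm piv with_gen S)
      moreover have "bracket (pivot k) (std_der (m, insert k S)) = (std_der (m, S) :: 'k grassmann \<Rightarrow> _)"
      proof
        fix h :: "'k grassmann"
        have "bracket (pivot k) (std_der (m, insert k S)) h = gmonom S * pivot (k + 2) h +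
            gen k * gmonom S * (pivot k (pivot (k + 2) h) + pivot (k + 2) (pivot k h))"
          by (simp add: bracket_def std_der_def gder_def insert_gmonom[OF S] 3 pivot_mult[OF char2]
              pivot_gmonom[OF S] pivot_gen_same distrib_left add.assoc)
        then show "bracket (pivot k) (std_der (m, insert k S)) h = std_der (m, S) h"
          unfolding pivot_commutator_add_2[OF char2] by (simp add: std_der_def gder_def 3)
      qed
      ultimately show ?thesis using le by simp
    qed
  qed (use less.prems lie_commutator.intros in \<open>auto simp: std_der_empty Std_def\<close>)
qed

lemma lieR_component_eq:
  assumes "CHAR('k::field) = 2"
  shows "lieR_component n = endo.span (std_ders n :: ('k grassmann \<Rightarrow> _) set)"
  unfolding lieR_component_def
proof (rule antisym)
  show "endo.span {a. lie_commutator n a} \<subseteq> endo.span (std_ders n :: ('k grassmann \<Rightarrow> _) set)"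
    using lie_commutator_in_span[OF assms] by (intro endo.span_minimal endo.subspace_span) blast
  show "endo.span (std_ders n :: ('k grassmann \<Rightarrow> _) set) \<subseteq> endo.span {a. lie_commutator n a}"
    using std_der_lie_commutator[OF assms] by (intro endo.span_mono) auto
qed

section \<open>Linear independence of the standard monomials\<close>

definition all_std :: "(nat \<times> nat set) set"
  where "all_std = {(m, S). S \<subseteq> {..<m - 1}}"

lemma Std_subset: "Std n \<subseteq> all_std"
  by (auto simp: Std_def all_std_def)

text \<open>Evaluation at the generators gives functionals dual to the standard monomials.\<close>

definition coord :: "nat \<times> nat set \<Rightarrow> ('k::field grassmann \<Rightarrow> 'k grassmann) \<Rightarrow> 'k"
  where "coord p a = gcoeff (a (gen (fst p))) (snd p)"

lemma coord_simps:
  "coord p 0 = 0" "coord p (a + b) = coord p a + coord p b" "coord p (escale c a) = c * coord p a"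
  by (simp_all add: coord_def escale_def)

lemma coord_sum: "coord p (sum h A) = (\<Sum>a\<in>A. coord p (h a))"
  by (induction A rule: infinite_finite_induct) (simp_all only: sum.infinite sum.empty sum.insert coord_simps not_False_eq_True)

text \<open>For m > k the pivot v_m kills x_k, for m = k the value at x_k is x_S, and for m < k the
  value is divisible by x_(k-1), a letter that T cannot contain.\<close>

lemma coord_std_der:
  assumes "p \<in> all_std" "q \<in> all_std"
  shows "coord p (std_der q) = (if p = q then 1 else 0 :: 'k::field)"
proof -
  obtain k T m S where pq: "p = (k, T)" "q = (m, S)" by fastforce
  then have T: "T \<subseteq> {..<k - 1}" and S: "S \<subseteq> {..<m - 1}" using assms by (auto simp: all_std_def)
  have fin: "finite T" "finite S" using S T finite_subset by blast+
  have e: "coord p (std_der q) = gcoeff (gmonom S * (pivot m (gen k) :: 'k grassmann)) T"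
    by (simp add: coord_def std_der_def gder_def pq)
  consider "m < k" | "m = k" | "m > k" by linarith
  then show ?thesis
  proof cases
    case 1
    then obtain g where "pivot m (gen k) = (gen (k - 1) * g :: 'k grassmann)"
      using pivot_gen_greater by blast
    then have "gmonom S * (pivot m (gen k) :: 'k grassmann) = gen (k - 1) * (gmonom S * g)"
      by (simp add: mult.left_commute)
    then have "coord p (std_der q) = (if k - 1 \<in> T then gcoeff (gmonom S * g) (T - {k - 1}) else 0)"
      unfolding e by (simp only: gen_mult_coeff[OF fin(1)])
    then show ?thesis using 1 T pq by auto
  next
    case 2
    then show ?thesis using fin unfolding e by (auto simp: pivot_gen_same gmonom.rep_eq pq)
  next
    case 3
    then show ?thesis unfolding e by (simp add: pivot_gen_less pq)
  qed
qed

lemma inj_on_std_der: "inj_on (std_der :: _ \<Rightarrow> 'k::field grassmann \<Rightarrow> _) all_std"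
proof (rule inj_onI)
  fix p q assume "p \<in> all_std" "q \<in> all_std" "std_der p = (std_der q :: 'k grassmann \<Rightarrow> _)"
  then show "p = q" using coord_std_der[of p p, where 'k = 'k] coord_std_der[of p q, where 'k = 'k]
    by (auto split: if_splits)
qed

lemma coord_span_eq_0:
  assumes a: "a \<in> endo.span (std_der ` Y)" and "Y \<subseteq> all_std" "p \<in> all_std" "p \<notin> Y"
  shows "coord p a = (0 :: 'k::field)"
proof -
  have sub: "endo.subspace {a. coord p a = (0 :: 'k)}"
    unfolding endo.subspace_def mem_Collect_eq coord_simps by simp
  have "coord p b = (0 :: 'k)" if "b \<in> std_der ` Y" for b
  proof -
    obtain q where "q \<in> Y" "b = std_der q" using \<open>b \<in> std_der ` Y\<close> by blast
    then show ?thesis using coord_std_der[of p q, where 'k = 'k] assms by auto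
  qed
  then show ?thesis by (rule endo.span_induct[OF a sub])
qed

lemma independent_std_ders: "endo.independent (std_ders n :: ('k::field grassmann \<Rightarrow> _) set)"
  unfolding endo.dependent_def
proof (rule notI, elim bexE)
  fix a :: "'k grassmann \<Rightarrow> 'k grassmann"
  assume "a \<in> std_ders n" and a: "a \<in> endo.span (std_ders n - {a})"
  then obtain p where p: "p \<in> Std n" "a = std_der p" by blast
  then have "std_ders n - {a} \<subseteq> std_der ` (Std n - {p})" by blast
  then have "a \<in> endo.span (std_der ` (Std n - {p}))" using a endo.span_mono by blast
  then have "coord p a = 0" by (rule coord_span_eq_0) (use p Std_subset in blast)+
  moreover have "coord p a = 1" using p Std_subset coord_std_der[of p p] by auto
  ultimately show False by simp
qed

lemma card_std_ders: "card (std_ders n :: ('k::field grassmann \<Rightarrow> _) set) = card (Std n)"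
  using inj_on_std_der inj_on_subset Std_subset by (blast intro: card_image)

lemma dim_lieR_component:
  assumes "CHAR('k::field) = 2"
  shows "endo.dim (lieR_component n :: ('k grassmann \<Rightarrow> _) set) = card (Std n)"
  unfolding lieR_component_eq[OF assms] endo.dim_span_eq_card_independent[OF independent_std_ders]
  by (rule card_std_ders)

section \<open>The lower central series\<close>

text \<open>The decreasing filtration attached to the gradation; it turns out to be the lower
  central series.\<close>

definition filt :: "nat \<Rightarrow> ('k::field grassmann \<Rightarrow> 'k grassmann) set"
  where "filt n = endo.span (\<Union>k\<in>{n..}. std_ders k)"

lemma bracket_filt:
  assumes "CHAR('k::field) = 2" and "a \<in> filt i" "b \<in> filt j"
  shows "bracket a b \<in> (filt (i + j) :: ('k grassmann \<Rightarrow> _) set)"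
  unfolding filt_def
proof (rule bracket_span[OF assms(2,3)[unfolded filt_def]])
  show "(\<Union>k\<in>{i..}. std_ders k) \<subseteq> (endomorphisms :: ('k grassmann \<Rightarrow> _) set)"
    "(\<Union>k\<in>{j..}. std_ders k) \<subseteq> (endomorphisms :: ('k grassmann \<Rightarrow> _) set)"
    using std_ders_endomorphisms by blast+
  fix x y :: "'k grassmann \<Rightarrow> 'k grassmann"
  assume "x \<in> (\<Union>k\<in>{i..}. std_ders k)" "y \<in> (\<Union>k\<in>{j..}. std_ders k)"
  then obtain k l where "i \<le> k" "x \<in> std_ders k" "j \<le> l" "y \<in> std_ders l" by auto
  then have "bracket x y \<in> endo.span (std_ders (k + l))" "k + l \<in> {i + j..}"
    using bracket_std_ders[OF assms(1)] by auto
  then show "bracket x y \<in> endo.span (\<Union>k\<in>{i + j..}. std_ders k)"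
    using endo.span_mono[of "std_ders (k + l)" "\<Union>k\<in>{i + j..}. std_ders k"] by blast
qed

lemma filt_mono: "m \<le> n \<Longrightarrow> filt n \<subseteq> filt m"
  unfolding filt_def by (intro endo.span_mono UN_mono) auto

lemma lie_commutator_in_lieR: "lie_commutator n a \<Longrightarrow> a \<in> lieR"
proof (induction rule: lie_commutator.induct)
  case (comm m a n b)
  then show ?case using lie_subalgebra_lieR unfolding lie_subalgebra_def by blast
qed (auto simp: lieR_def intro: hull_inc)

lemma lieR_eq_filt:
  assumes char2: "CHAR('k::field) = 2"
  shows "lieR = (filt 1 :: ('k grassmann \<Rightarrow> _) set)"
proof
  have "filt 1 \<subseteq> (endomorphisms :: ('k grassmann \<Rightarrow> _) set)"
    unfolding filt_def using std_ders_endomorphisms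
    by (intro endo.span_minimal subspace_endomorphisms) blast
  moreover have "bracket a b \<in> filt 1" if "a \<in> filt 1" "b \<in> filt 1" for a b :: "'k grassmann \<Rightarrow> _"
    by (rule subsetD[OF filt_mono bracket_filt[OF char2 that]]) simp
  ultimately have "lie_subalgebra (filt 1 :: ('k grassmann \<Rightarrow> _) set)"
    by (simp add: lie_subalgebra_def filt_def)
  moreover have "{pivot 0, pivot 1} \<subseteq> (filt 1 :: ('k grassmann \<Rightarrow> _) set)"
    unfolding filt_def using pivot_std_ders by (auto intro!: endo.span_base)
  ultimately show "lieR \<subseteq> (filt 1 :: ('k grassmann \<Rightarrow> _) set)"
    unfolding lieR_def by (intro hull_minimal)
  have "std_ders k \<subseteq> (lieR :: ('k grassmann \<Rightarrow> _) set)" for k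
  proof
    fix x :: "'k grassmann \<Rightarrow> 'k grassmann"
    assume "x \<in> std_ders k"
    then have "lie_commutator k x" using std_der_lie_commutator[OF char2] by auto
    then show "x \<in> lieR" by (rule lie_commutator_in_lieR)
  qed
  then show "(filt 1 :: ('k grassmann \<Rightarrow> _) set) \<subseteq> lieR"
    unfolding filt_def using lie_subalgebra_lieR
    by (intro endo.span_minimal) (auto simp: lie_subalgebra_def)
qed

section \<open>Left-normed commutators and the terms of the series\<close>

lemma bracket_jacobi:
  fixes a b c :: "'k::field grassmann \<Rightarrow> 'k grassmann"
  assumes char2: "CHAR('k) = 2" and "a \<in> endomorphisms" "b \<in> endomorphisms" "c \<in> endomorphisms"
  shows "bracket (bracket a b) c = bracket a (bracket b c) + bracket b (bracket a c)"
proof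
  fix h
  \<comment> \<open>Each of the six products of a, b and c occurs twice, so characteristic 2 cancels
    everything.\<close>
  have "bracket (bracket a b) c h + (bracket a (bracket b c) h + bracket b (bracket a c) h) =
    (a (b (c h)) + a (b (c h))) + (b (a (c h)) + b (a (c h))) + (c (a (b h)) + c (a (b h))) +
    (c (b (a h)) + c (b (a h))) + (a (c (b h)) + a (c (b h))) + (b (c (a h)) + b (c (a h)))"
    using assms(2-) by (simp add: bracket_def endomorphisms_iff algebra_simps)
  also have "\<dots> = 0" by (simp only: grassmann_double[OF char2] add_0)
  finally show "bracket (bracket a b) c h = (bracket a (bracket b c) + bracket b (bracket a c)) h"
    using grassmann_double[OF char2] by (metis add_right_cancel plus_fun_apply)
qed

lemma lie_commutator_endomorphism: "lie_commutator n a \<Longrightarrow> a \<in> endomorphisms"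
  using lie_commutator_in_lieR lie_subalgebra_lieR by (auto simp: lie_subalgebra_def)

text \<open>Induction on the first factor, which the Jacobi identity makes shorter. The series
  brackets with the whole algebra once per step, while an arbitrary commutator may split into two
  short factors; splitting off one generator repairs this.\<close>

lemma lie_commutator_left_normed:
  fixes a b :: "'k::field grassmann \<Rightarrow> 'k grassmann"
  assumes char2: "CHAR('k) = 2" and "lie_commutator i a" "lie_commutator j b"
  shows "bracket a b \<in> endo.span {bracket c d | c d. lie_commutator 1 c \<and> lie_commutator (i + j - 1) d}"
  using assms(2,3)
proof (induction arbitrary: j b)
  case gen0
  show ?case
    by (rule endo.span_base, rule CollectI, rule exI[of _ "pivot 0"], rule exI[of _ b])
      (use gen0 lie_commutator.gen0 in simp)
next
  case gen1
  show ?case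
    by (rule endo.span_base, rule CollectI, rule exI[of _ "pivot 1"], rule exI[of _ b])
      (use gen1 lie_commutator.gen1 in simp)
next
  case (comm m a n c)
  have "bracket a (bracket c b) \<in>
      endo.span {bracket c d | c d. lie_commutator 1 c \<and> lie_commutator (m + n + j - 1) d}"
    using comm.IH(1)[OF lie_commutator.comm[OF comm.hyps(2) comm.prems]] by (simp add: add.assoc)
  moreover have "bracket c (bracket a b) \<in>
      endo.span {bracket c d | c d. lie_commutator 1 c \<and> lie_commutator (m + n + j - 1) d}"
    using comm.IH(2)[OF lie_commutator.comm[OF comm.hyps(1) comm.prems]] by (simp add: add.left_commute add.assoc)
  ultimately show ?case
    using comm by (subst bracket_jacobi[OF char2]) (auto intro: lie_commutator_endomorphism endo.span_add)
qed

text \<open>Additivity of degrees gives one inclusion. Conversely, a standard monomial of degree k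
  >= n + 2 is a combination of brackets of a generator with a commutator of length k - 1 >= n +
  1.\<close>

lemma lieR_lower_central_eq_filt:
  assumes char2: "CHAR('k::field) = 2"
  shows "lieR_lower_central (Suc n) = (filt (Suc n) :: ('k grassmann \<Rightarrow> _) set)"
proof (induction n)
  case 0
  then show ?case using lieR_eq_filt[OF char2] by simp
next
  case (Suc n)
  let ?C = "{bracket a b | a b. a \<in> lieR \<and> b \<in> (filt (Suc n) :: ('k grassmann \<Rightarrow> _) set)}"
  have "endo.span ?C = filt (Suc (Suc n))"
  proof (rule antisym)
    have "?C \<subseteq> filt (Suc (Suc n))"
      using bracket_filt[OF char2, of _ 1 _ "Suc n"] lieR_eq_filt[OF char2] by auto
    then show "endo.span ?C \<subseteq> filt (Suc (Suc n))"
      by (rule endo.span_minimal) (simp add: filt_def)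
    have "std_ders k \<subseteq> endo.span ?C" if k: "Suc (Suc n) \<le> k" for k
    proof
      fix x :: "'k grassmann \<Rightarrow> 'k grassmann"
      assume "x \<in> std_ders k"
      then have "lie_commutator k x" using std_der_lie_commutator[OF char2] by auto
      then have "x \<in> endo.span {bracket c d | c d. lie_commutator 1 c \<and> lie_commutator (k - 1) d}"
      proof cases
        case (comm i a j b)
        then show ?thesis using lie_commutator_left_normed[OF char2] by blast
      qed (use k in auto)
      moreover have "d \<in> filt (Suc n)" if "lie_commutator (k - 1) d" for d :: "'k grassmann \<Rightarrow> _"
      proof -
        have "k - 1 \<in> {Suc n..}" using k by auto
        then have "endo.span (std_ders (k - 1)) \<subseteq> (filt (Suc n) :: ('k grassmann \<Rightarrow> _) set)"
          unfolding filt_def by (intro endo.span_mono) blast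
        then show ?thesis using lie_commutator_in_span[OF char2 that] by blast
      qed
      ultimately show "x \<in> endo.span ?C"
        using lie_commutator_in_lieR
        by (blast intro: subsetD[OF endo.span_mono, rotated])
    qed
    then show "filt (Suc (Suc n)) \<subseteq> endo.span ?C"
      unfolding filt_def by (intro endo.span_minimal) auto
  qed
  then show ?case by (simp add: Suc.IH)
qed

text \<open>A standard monomial has only one degree, so the functionals \<open>coord p\<close> with
  p in \<open>Std n\<close> vanish on the next term of the filtration and detect independence modulo
  it.\<close>

lemma quotient_dim_filt:
  assumes "finite (Std n)"
  shows "quotient_dim (filt n :: ('k::field grassmann \<Rightarrow> _) set) (filt (n + 1)) (card (Std n))"
  unfolding quotient_dim_def
proof (intro conjI exI[of _ "std_ders n"])
  let ?B = "std_ders n :: ('k grassmann \<Rightarrow> _) set"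
  let ?W = "filt (n + 1) :: ('k grassmann \<Rightarrow> _) set"
  show "?W \<subseteq> filt n" by (rule filt_mono) simp
  show fin: "finite ?B" using assms by simp
  show "card ?B = card (Std n)" by (rule card_std_ders)
  show "?B \<subseteq> filt n" unfolding filt_def by (intro order_trans[OF _ endo.span_superset]) auto
  show "\<forall>u. (\<Sum>b\<in>?B. escale (u b) b) \<in> ?W \<longrightarrow> (\<forall>b\<in>?B. u b = 0)"
  proof (intro allI impI ballI)
    fix u :: "('k grassmann \<Rightarrow> 'k grassmann) \<Rightarrow> 'k" and b
    assume W: "(\<Sum>b\<in>?B. escale (u b) b) \<in> ?W" and "b \<in> ?B"
    then obtain p where p: "p \<in> Std n" "b = std_der p" by blast
    have "p \<notin> (\<Union>k\<in>{n + 1..}. Std k)" using p by (auto simp: Std_def)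
    moreover have "(\<Sum>b\<in>?B. escale (u b) b) \<in> endo.span (std_der ` (\<Union>k\<in>{n + 1..}. Std k))"
      using W by (simp add: filt_def image_UN)
    ultimately have "coord p (\<Sum>b\<in>?B. escale (u b) b) = 0"
      using p Std_subset by (intro coord_span_eq_0[where Y = "\<Union>k\<in>{n + 1..}. Std k"]) auto
    moreover have "coord p (\<Sum>b\<in>?B. escale (u b) b) = (\<Sum>c\<in>?B. if c = b then u b else 0)"
      unfolding coord_sum
    proof (intro sum.cong refl)
      fix c assume "c \<in> ?B"
      then obtain q where "q \<in> Std n" "c = std_der q" by blast
      moreover from this have "p \<in> all_std" "q \<in> all_std" using p Std_subset by blast+
      ultimately show "coord p (escale (u c) c) = (if c = b then u b else 0)"
        using p coord_std_der[of p q, where 'k = 'k] coord_std_der[of p p, where 'k = 'k]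
        by (auto simp: coord_simps)
    qed
    ultimately show "u b = 0" using fin \<open>b \<in> ?B\<close> by (simp add: sum.delta)
  qed
  show "\<forall>x\<in>filt n. \<exists>u. x - (\<Sum>b\<in>?B. escale (u b) b) \<in> ?W"
  proof
    fix x :: "'k grassmann \<Rightarrow> 'k grassmann"
    assume "x \<in> filt n"
    moreover have "{n..} = insert n {n + 1..}" by auto
    ultimately have "x \<in> endo.span (?B \<union> (\<Union>k\<in>{n + 1..}. std_ders k))"
      by (simp add: filt_def UN_insert)
    then obtain y z where "x = y + z" "y \<in> endo.span ?B" and z: "z \<in> ?W"
      unfolding endo.span_Un filt_def by auto
    then obtain u where "y = (\<Sum>b\<in>?B. escale (u b) b)"
      unfolding endo.span_finite[OF fin] by auto
    then show "\<exists>u. x - (\<Sum>b\<in>?B. escale (u b) b) \<in> ?W"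
      using z \<open>x = y + z\<close> by (intro exI[of _ u]) simp
  qed
qed


section \<open>Counting standard monomials\<close>

lemma wt_mono: "m \<le> n \<Longrightarrow> wt m \<le> wt n"
  using lift_Suc_mono_le[of wt m n] wt_le_Suc by simp

lemma le_wt: "n \<le> wt n"
proof (induction n rule: wt.induct)
  case (3 n)
  then show ?case using wt_pos[of n] by simp
qed auto

text \<open>The coefficient of t^d in the product of 1 + t^(wt i) over i < k.\<close>

definition subset_sums :: "nat \<Rightarrow> nat \<Rightarrow> nat"
  where "subset_sums k d = card {S. S \<subseteq> {..<k} \<and> sum wt S = d}"

lemma finite_subsets: "finite {S. S \<subseteq> {..<k::nat} \<and> P S}"
  by (rule finite_subset[of _ "Pow {..<k}"]) auto

lemma subset_sums_0: "subset_sums 0 d = (if d = 0 then 1 else 0)"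
proof -
  have "{S. S \<subseteq> {..<0::nat} \<and> sum wt S = d} = (if d = 0 then {{}} else {})" by auto
  then show ?thesis by (simp add: subset_sums_def)
qed

text \<open>The two summands count the sets without and with k. The guard keeps truncated
  subtraction from counting the empty set at degrees below \<open>wt k\<close>.\<close>

lemma subset_sums_Suc:
  "subset_sums (Suc k) d = subset_sums k d + (if wt k \<le> d then subset_sums k (d - wt k) else 0)"
proof -
  let ?A = "\<lambda>k d. {S. S \<subseteq> {..<k} \<and> sum wt S = d}"
  let ?B = "{S. S \<subseteq> {..<k} \<and> sum wt S + wt k = d}"
  have ins: "sum wt (insert k S) = sum wt S + wt k" if "S \<subseteq> {..<k}" for S
  proof -
    have "finite S" "k \<notin> S" using that finite_subset by auto
    then show ?thesis by simp
  qed
  have "?A (Suc k) d = ?A k d \<union> insert k ` ?B"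
  proof (intro equalityI subsetI)
    fix S assume S: "S \<in> ?A (Suc k) d"
    show "S \<in> ?A k d \<union> insert k ` ?B"
    proof (cases "k \<in> S")
      case True
      have "S - {k} \<subseteq> {..<k}" using S by (auto simp: less_Suc_eq)
      moreover have "insert k (S - {k}) = S" using True by blast
      ultimately have "S - {k} \<in> ?B" using S ins[of "S - {k}"] by simp
      then show ?thesis using \<open>insert k (S - {k}) = S\<close> by blast
    next
      case False
      then show ?thesis using S less_Suc_eq by auto
    qed
  next
    fix S assume "S \<in> ?A k d \<union> insert k ` ?B"
    then show "S \<in> ?A (Suc k) d" using ins by auto
  qed
  moreover have "inj_on (insert k) ?B"
  proof (rule inj_onI)
    fix S T assume "S \<in> ?B" "T \<in> ?B" "insert k S = insert k T"
    then show "S = T" by (metis (no_types, lifting) insert_ident lessThan_iff less_irrefl mem_Collect_eq subsetD)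
  qed
  moreover have "?A k d \<inter> insert k ` ?B = {}" by auto
  ultimately have "subset_sums (Suc k) d = subset_sums k d + card ?B"
    by (simp add: subset_sums_def card_Un_disjoint finite_subsets card_image)
  moreover have "?B = (if wt k \<le> d then ?A k (d - wt k) else {})" by auto
  ultimately show ?thesis by (simp add: subset_sums_def)
qed

text \<open>Replacing \<open>S\<close> by its complement turns the weight into a subset sum.\<close>

lemma card_level:
  "card {S. S \<subseteq> {..<k} \<and> wt m = n + sum wt S} =
    (if wt m \<le> n + sum wt {..<k} then subset_sums k (n + sum wt {..<k} - wt m) else 0)"
proof -
  have compl: "sum wt ({..<k} - S) + sum wt S = sum wt {..<k}" if "S \<subseteq> {..<k}" for S
    using sum.subset_diff[OF that, of wt] by simp
  let ?A = "{S. S \<subseteq> {..<k} \<and> wt m = n + sum wt S}"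
  let ?B = "{S. S \<subseteq> {..<k} \<and> wt m + sum wt S = n + sum wt {..<k}}"
  have "{..<k} - S \<in> ?B" if "S \<in> ?A" for S
    using that compl[of S] by auto
  moreover have "{..<k} - S \<in> ?A" if "S \<in> ?B" for S
    using that compl[of S] by auto
  ultimately have "bij_betw (\<lambda>S. {..<k} - S) ?A ?B"
    by (intro bij_betw_byWitness[where f' = "\<lambda>S. {..<k} - S"] image_subsetI)
      (auto simp only: double_diff[OF _ order_refl] mem_Collect_eq)
  then have "card ?A = card ?B" by (rule bij_betw_same_card)
  also have "{S. S \<subseteq> {..<k} \<and> wt m + sum wt S = n + sum wt {..<k}} =
      (if wt m \<le> n + sum wt {..<k} then {S. S \<subseteq> {..<k} \<and> sum wt S = n + sum wt {..<k} - wt m} else {})"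
    by auto
  finally show ?thesis by (simp add: subset_sums_def)
qed

lemma Std_bounds:
  assumes "(m, S) \<in> Std n" "1 \<le> m"
  shows "n \<le> wt m" "wt (m - 1) + (if even m then 1 else 0) \<le> n"
proof -
  have S: "S \<subseteq> {..<m - 1}" "wt m = n + sum wt S" using assms by (auto simp: Std_def)
  then show "n \<le> wt m" by simp
  have "sum wt S \<le> sum wt {..<m - 1}" using S by (intro sum_mono2) auto
  then show "wt (m - 1) + (if even m then 1 else 0) \<le> n"
    using S(2) sum_wt[of "m - 1"] wt_Suc[of "m - 1"] assms(2) by (auto split: if_splits)
qed

lemma finite_Std: "finite (Std n)"
proof (rule finite_subset)
  show "Std n \<subseteq> (SIGMA m:{..n + 1}. {S. S \<subseteq> {..<m - 1} \<and> wt m = n + sum wt S})"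
  proof safe
    fix m S assume mS: "(m, S) \<in> Std n"
    then show "m \<le> n + 1" using Std_bounds(2)[OF mS] le_wt[of "m - 1"] by (cases "m = 0") auto
    show "x < m - 1" if "x \<in> S" for x using that mS by (auto simp: Std_def)
    show "wt m = n + sum wt S" using mS by (auto simp: Std_def)
  qed
  show "finite (SIGMA m:{..n + 1}. {S. S \<subseteq> {..<m - 1} \<and> wt m = n + sum wt S})"
    by (intro finite_SigmaI finite_subsets) simp
qed

text \<open>Only v_(k+1) and v_(k+2) contribute. Their windows run from w_k + 1 to w_(k+1) and from
  w_(k+1) to w_(k+2), so they share just the degree w_(k+1).\<close>

lemma card_Std:
  assumes k: "odd k" and "wt k < n" "n \<le> wt (k + 2)"
  shows "card (Std n) = subset_sums k (n - wt k - 1) +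
    (if wt (k + 1) \<le> n then subset_sums (k + 1) (n - wt (k + 1)) else 0)"
proof -
  let ?A = "\<lambda>m. {S. S \<subseteq> {..<m - 1} \<and> wt m = n + sum wt S}"
  have "Std n = (SIGMA m:{k + 1, k + 2}. ?A m)"
  proof (intro equalityI subsetI)
    fix p assume p: "p \<in> Std n"
    then obtain m S where mS: "p = (m, S)" "(m, S) \<in> Std n" by (cases p) auto
    have "1 \<le> m" using mS(2) assms wt_pos[of k] by (cases m) (auto simp: Std_def)
    note b = Std_bounds[OF mS(2) this]
    have "k < m" using b(1) assms wt_mono[of m k] by linarith
    moreover have "m < k + 3"
    proof (rule ccontr)
      assume "\<not> m < k + 3"
      then consider "m = k + 3" | "k + 3 \<le> m - 1" by linarith
      then show False
      proof cases
        case 1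
        \<comment> \<open>As k + 3 is even, its window starts one degree later; this allows n to
          attain \<open>wt (k + 2)\<close>.\<close>
        then have "wt (k + 2) + 1 \<le> n" using b(2) k by simp
        then show False using assms by simp
      next
        case 2
        then have "wt (k + 3) \<le> n" using b(2) wt_mono[OF 2] by simp
        moreover have "wt (k + 2) < wt (k + 3)"
          using wt_pos[of "k + 1"] by (simp add: eval_nat_numeral)
        ultimately show False using assms by simp
      qed
    qed
    ultimately have "m = k + 1 \<or> m = k + 2" by linarith
    then show "p \<in> (SIGMA m:{k + 1, k + 2}. ?A m)" using mS by (auto simp: Std_def)
  qed (auto simp: Std_def)
  then have "card (Std n) = (\<Sum>m\<in>{k + 1, k + 2}. card (?A m))"
    by (simp only: card_SigmaI[OF _ ballI[OF finite_subsets]] finite.intros)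
  also have "\<dots> = card {S. S \<subseteq> {..<k} \<and> wt (k + 1) = n + sum wt S} +
      card {S. S \<subseteq> {..<k + 1} \<and> wt (k + 2) = n + sum wt S}"
    by simp
  finally have card: "card (Std n) = card {S. S \<subseteq> {..<k} \<and> wt (k + 1) = n + sum wt S} +
      card {S. S \<subseteq> {..<k + 1} \<and> wt (k + 2) = n + sum wt S}" .
  show ?thesis
  proof -
    have "sum wt {..<k} = wt k" "wt (k + 1) = 2 * wt k + 1" "sum wt {..<k + 1} + 1 = wt (k + 1)"
      "wt (k + 2) + 1 = 2 * wt (k + 1)"
      using sum_wt[of k] sum_wt[of "k + 1"] wt_Suc[of k] wt_Suc[of "k + 1"] k by simp_all
    then have "n + sum wt {..<k} - wt (k + 1) = n - wt k - 1" "wt (k + 1) \<le> n + sum wt {..<k}"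
      "n + sum wt {..<k + 1} - wt (k + 2) = n - wt (k + 1)"
      "wt (k + 2) \<le> n + sum wt {..<k + 1} \<longleftrightarrow> wt (k + 1) \<le> n"
      using assms by linarith+
    then show ?thesis unfolding card card_level by (simp only: if_True)
  qed
qed

text \<open>\<open>row m\<close> is the coefficient sequence of \<open>\<Prod>\<^sub>i\<^sub><\<^sub>m (1 + t\<^bsup>wt i\<^esup>)\<close> for \<open>m \<ge> 3\<close>. Multiplication
  by \<open>1 + t\<^bsup>wt m\<^esup>\<close> puts two copies side by side for even \<open>m\<close>; for odd \<open>m\<close> they overlap in one
  entry \<open>1 + 1\<close>, and this is where the long blocks come from.\<close>

fun blocks :: "nat \<Rightarrow> nat list list" where
  "blocks 0 = []"
| "blocks (Suc m) = (if m < 3 then [] else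
    blocks m @ (if odd m then [[1, 1, 2, 2, 2]] else [[1, 1, 2], [1, 1, 2]]) @ blocks m)"

definition row :: "nat \<Rightarrow> nat list"
  where "row m = [1, 2] @ concat (blocks m) @ [1, 1, 2, 1]"

text \<open>The built-in 2 is the sum of the shared end entries, both of which are 1 wherever this
  is used.\<close>

definition merge :: "nat list \<Rightarrow> nat list \<Rightarrow> nat list"
  where "merge xs ys = butlast xs @ [2] @ tl ys"

definition entry :: "nat list \<Rightarrow> nat \<Rightarrow> nat"
  where "entry xs k = (if k < length xs then xs ! k else 0)"

lemma entry_append: "entry (xs @ ys) k = entry xs k + (if length xs \<le> k then entry ys (k - length xs) else 0)"
  by (auto simp: entry_def nth_append)

lemma entry_merge:
  assumes "xs \<noteq> []" "last xs = 1" "ys \<noteq> []" "hd ys = 1"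
  shows "entry (merge xs ys) k = entry xs k + (if length xs - 1 \<le> k then entry ys (k - (length xs - 1)) else 0)"
proof -
  obtain as where xs: "xs = as @ [1]" using assms by (metis append_butlast_last_id)
  obtain bs where ys: "ys = 1 # bs" using assms by (metis list.collapse)
  show ?thesis
    by (auto simp: merge_def xs ys entry_def nth_append nth_Cons' Suc_diff_le)
qed

lemma length_row:
  assumes "3 \<le> m"
  shows "length (row m) = sum wt {..<m} + 1"
  using assms
proof (induction m rule: dec_induct)
  case base
  then show ?case by (simp add: row_def eval_nat_numeral)
next
  case (step m)
  then show ?case using sum_wt[of m] by (auto simp: row_def split: if_splits)
qed

text \<open>At the seam the ending 1, 1, 2, 1 meets the beginning 1, 2. Side by side they read as
  two blocks 1, 1, 2; overlapping, as one block 1, 1, 2, 2, 2.\<close>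

lemma row_Suc:
  assumes "3 \<le> m"
  shows "row (Suc m) = (if odd m then merge (row m) (row m) else row m @ row m)"
  using assms by (simp add: row_def merge_def butlast_append)

lemma row_ends: "row m \<noteq> []" "hd (row m) = 1" "last (row m) = 1"
  by (simp_all add: row_def)

text \<open>The shift \<open>wt m\<close> equals the length of \<open>row m\<close> for even m and
  one less for odd m, which is adjacency and overlap respectively.\<close>

lemma subset_sums_eq_row:
  assumes "3 \<le> m"
  shows "subset_sums m k = entry (row m) k"
  using assms
proof (induction m arbitrary: k rule: dec_induct)
  case base
  have "subset_sums 3 k = entry [1, 2, 1, 1, 2, 1] k"
  proof (cases "k < 6")
    case True
    then have "k \<in> {0, 1, 2, 3, 4, 5}" by auto
    then show ?thesis
      by (auto simp: eval_nat_numeral subset_sums_Suc subset_sums_0 entry_def)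
  next
    case False
    then show ?thesis
      by (auto simp: eval_nat_numeral subset_sums_Suc subset_sums_0 entry_def)
  qed
  then show ?case by (simp add: row_def eval_nat_numeral)
next
  case (step m)
  then show ?case
    using sum_wt[of m]
    by (auto simp: subset_sums_Suc row_Suc entry_append entry_merge row_ends length_row)
qed

section \<open>Block decomposition of the dimension sequence\<close>

text \<open>Stage j lists the blocks covering the degrees from 5 to w_(2j+3) - 1; one step adds the
  contributions of two further pivots.\<close>

fun prefix :: "nat \<Rightarrow> nat list list" where
  "prefix 0 = []"
| "prefix (Suc j) = prefix j @ [[1, 1, 2]] @ blocks (2 * j + 3) @ [[1, 1, 2, 2, 2]] @
    blocks (2 * j + 4) @ [[1, 1, 2]]"

text \<open>The extra 1 is the entry at degree w_(2j+3). It opens the next block, completing the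
  leading 1, 2 of the row to 1, 1, 2, and every stage leaves such a 1 behind.\<close>

lemma concat_prefix_Suc:
  "concat (prefix (Suc j)) @ [1] = concat (prefix j) @ [1] @ merge (row (2 * j + 3)) (row (2 * j + 4))"
  by (simp add: row_def merge_def butlast_append)

lemma length_concat_prefix: "length (concat (prefix j)) + 5 = wt (2 * j + 3)"
proof (induction j)
  case 0
  then show ?case by (simp add: eval_nat_numeral)
next
  case (Suc j)
  have "length (concat (prefix (Suc j))) =
      length (concat (prefix j)) + length (merge (row (2 * j + 3)) (row (2 * j + 4)))"
    using arg_cong[OF concat_prefix_Suc[of j], of length] by simp
  also have "\<dots> = length (concat (prefix j)) + (sum wt {..<2 * j + 3} + sum wt {..<2 * j + 4} + 1)"
    by (simp add: merge_def length_row)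
  finally have "length (concat (prefix (Suc j))) + 6 =
      length (concat (prefix j)) + 5 + sum wt {..<2 * j + 3} + (sum wt {..<2 * j + 4} + 1) + 1"
    by simp
  also have "\<dots> = wt (2 * j + 5) + 1"
  proof -
    have "sum wt {..<2 * j + 3} = wt (2 * j + 3)" "sum wt {..<2 * j + 4} + 1 = wt (2 * j + 4)"
      using sum_wt[of "2 * j + 3"] sum_wt[of "2 * j + 4"] by simp_all
    moreover have "wt (2 * j + 5) = wt (2 * j + 4) + 2 * wt (2 * j + 3)"
      by (simp add: numeral_eq_Suc)
    ultimately show ?thesis using Suc by simp
  qed
  finally show ?case by (simp add: add.commute)
qed

text \<open>For k = 2j + 3 the two summands of \<open>card_Std\<close> are offset by w_(k+1) - w_k -
  1 = w_k, the length of \<open>row k\<close> minus 1, so their sum is an entry of the merged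
  rows.\<close>

lemma card_Std_prefix:
  "i \<le> length (concat (prefix j)) \<Longrightarrow> card (Std (5 + i)) = (concat (prefix j) @ [1]) ! i"
proof (induction j arbitrary: i)
  case 0
  have "card (Std 5) = 1"
    using card_Std[of 1 5] by (simp add: eval_nat_numeral subset_sums_Suc subset_sums_0)
  then show ?case using 0 by simp
next
  case (Suc j)
  let ?l = "length (concat (prefix j))"
  show ?case
  proof (cases "i \<le> ?l")
    case True
    then show ?thesis unfolding concat_prefix_Suc using Suc.IH[OF True] by (simp add: nth_append)
  next
    case False
    define k where "k = 2 * j + 3"
    let ?r = "merge (row k) (row (k + 1))"
    have k: "odd k" "3 \<le> k" by (simp_all add: k_def)
    have concat_Suc: "concat (prefix (Suc j)) @ [1] = concat (prefix j) @ [1] @ ?r"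
      using concat_prefix_Suc[of j] by (simp add: k_def add.commute)
    have l: "?l + 5 = wt k" unfolding k_def by (rule length_concat_prefix)
    have "2 * Suc j + 3 = k + 2" by (simp add: k_def)
    then have "length (concat (prefix (Suc j))) + 5 = wt (k + 2)"
      using length_concat_prefix[of "Suc j"] by metis
    then have bounds: "wt k < 5 + i" "5 + i \<le> wt (k + 2)" "i - ?l - 1 = 5 + i - wt k - 1"
      using Suc.prems False l by linarith+
    have "i < length (concat (prefix (Suc j)) @ [1])" using Suc.prems by simp
    then have lt: "i - ?l - 1 < length ?r"
      using False unfolding concat_Suc by auto
    have w: "length (row k) - 1 = wt k" "wt (k + 1) = 2 * wt k + 1"
      using sum_wt[of k] wt_Suc[of k] k by (simp_all add: length_row)
    then have "wt (k + 1) \<le> 5 + i \<longleftrightarrow> length (row k) - 1 \<le> 5 + i - wt k - 1"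
      "5 + i - wt (k + 1) = 5 + i - wt k - 1 - (length (row k) - 1)"
      using bounds by linarith+
    then have "card (Std (5 + i)) = entry ?r (i - ?l - 1)"
      unfolding entry_merge[OF row_ends(1,3,1,2)] bounds(3) card_Std[OF k(1) bounds(1,2)]
      using k by (simp add: subset_sums_eq_row)
    also have "\<dots> = ?r ! (i - ?l - 1)" using lt by (simp add: entry_def)
    also have "\<dots> = (concat (prefix (Suc j)) @ [1]) ! i"
      unfolding concat_Suc using False by (simp add: nth_append nth_Cons')
    finally show ?thesis .
  qed
qed

lemma set_blocks: "set (blocks m) \<subseteq> {[1, 1, 2], [1, 1, 2, 2, 2]}"
  by (induction m) auto

lemma set_prefix: "set (prefix j) \<subseteq> {[1, 1, 2], [1, 1, 2, 2, 2]}"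
  by (induction j) (use set_blocks in auto)

lemma length_prefix: "j \<le> length (prefix j)"
  by (induction j) auto

lemma take_prefix: "j \<le> l \<Longrightarrow> take (length (prefix j)) (prefix l) = prefix j"
proof -
  assume "j \<le> l"
  then have "\<exists>ys. prefix l = prefix j @ ys"
    by (induction l rule: dec_induct) auto
  then show ?thesis by auto
qed

lemma nth_concat_eq:
  assumes "k < length xss" "j < length (xss ! k)"
  shows "concat xss ! ((\<Sum>i<k. length (xss ! i)) + j) = xss ! k ! j"
    and "(\<Sum>i<k. length (xss ! i)) + j < length (concat xss)"
proof -
  have "xss = take k xss @ xss ! k # drop (Suc k) xss" using assms by (simp add: id_take_nth_drop)
  then have c: "concat xss = concat (take k xss) @ xss ! k @ concat (drop (Suc k) xss)"
    by (metis concat.simps(2) concat_append)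
  have "length (concat (take k xss)) = (\<Sum>i<k. length (xss ! i))"
    using assms(1) by (auto simp: length_concat sum_list_sum_nth atLeast0LessThan intro!: sum.cong)
  then show "concat xss ! ((\<Sum>i<k. length (xss ! i)) + j) = xss ! k ! j"
    "(\<Sum>i<k. length (xss ! i)) + j < length (concat xss)"
    using assms(2) by (auto simp: c nth_append)
qed

text \<open>Each stage extends the previous ones and stage k + 1 has more than k blocks, so block k
  can be read off there unambiguously.\<close>

lemma card_Std_blocks:
  "\<exists>block :: nat \<Rightarrow> nat list. (\<forall>k. block k = [1, 1, 2] \<or> block k = [1, 1, 2, 2, 2]) \<and>
    (\<forall>k. \<forall>j < length (block k). card (Std (5 + (\<Sum>i<k. length (block i)) + j)) = block k ! j)"
proof (intro exI conjI allI impI)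
  define block where "block k = prefix (Suc k) ! k" for k
  have len: "k < length (prefix (Suc k))" for k using length_prefix[of "Suc k"] by simp
  have block: "block i = prefix (Suc k) ! i" if "i \<le> k" for i k
    using take_prefix[of "Suc i" "Suc k"] that len[of i] unfolding block_def by (metis Suc_le_mono nth_take)
  show "block k = [1, 1, 2] \<or> block k = [1, 1, 2, 2, 2]" for k
    using set_prefix[of "Suc k"] nth_mem[OF len[of k]] unfolding block_def by blast
  fix k j assume j: "j < length (block k)"
  let ?p = "(\<Sum>i<k. length (block i)) + j"
  have p: "?p = (\<Sum>i<k. length (prefix (Suc k) ! i)) + j"
    using block[of _ k] by (simp del: prefix.simps)
  note n = nth_concat_eq[OF len, of j k, folded block_def, OF j, unfolded block_def]
  have "?p < length (concat (prefix (Suc k)))" unfolding p by (rule n(2))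
  then have "card (Std (5 + ?p)) = concat (prefix (Suc k)) ! ?p"
    using card_Std_prefix[of ?p "Suc k"] by (simp only: nth_append if_True less_imp_le)
  also have "\<dots> = block k ! j" unfolding p block_def[of k] by (rule n(1))
  finally show "card (Std (5 + (\<Sum>i<k. length (block i)) + j)) = block k ! j"
    by (simp add: add.assoc)
qed

text \<open>If \<open>m\<close> is even, then in \<open>row (m + 2)\<close> the first copy of \<open>row m\<close> ends with its own \<open>1\<close>, whereas
  the second one ends in an overlap \<open>2\<close>. An entry determined by the one \<open>p\<close> places before would
  have to be the same in both.\<close>

lemma card_Std_not_periodic:
  "\<not> (\<exists>N p. 0 < p \<and> (\<forall>n\<ge>N. card (Std (n + p)) = card (Std n)))"
proof
  assume "\<exists>N p. 0 < p \<and> (\<forall>n\<ge>N. card (Std (n + p)) = card (Std n))"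
  then obtain N p where p: "0 < p" and per: "\<And>n. N \<le> n \<Longrightarrow> card (Std (n + p)) = card (Std n)"
    by blast
  \<comment> \<open>Even, and large enough that s exceeds N + p.\<close>
  define m where "m = 2 * (N + p + 3)"
  define s where "s = sum wt {..<m}"
  have m: "even m" "3 \<le> m" by (simp_all add: m_def)
  have s: "wt m = s + 1" "wt (m + 1) = 2 * s + 1" "wt (m + 2) = 4 * s + 3" "wt (m + 3) = 8 * s + 5"
    using sum_wt[of m] m wt_Suc[of m] wt_Suc[of "m + 1"] wt_Suc[of "m + 2"]
    by (auto simp: s_def eval_nat_numeral)
  have big: "N + p < s" using le_wt[of m] s by (simp add: m_def)
  have len: "length (row m) = s + 1" "length (row (m + 1)) = 2 * s + 2"
    using m length_row[of m] length_row[of "m + 1"] s by (simp_all add: s_def)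
  have row1: "row (m + 1) = row m @ row m" and row2: "row (m + 2) = merge (row (m + 1)) (row (m + 1))"
    using m row_Suc[of m] row_Suc[of "m + 1"] by simp_all
  \<comment> \<open>For k > 0 the window of v_(m+2) is exhausted, so only v_(m+3) contributes; its
    window ends after w_(m+3) - w_(m+2) = 4s + 2 steps.\<close>
  have eq: "card (Std (wt (m + 2) + k)) = entry (row (m + 2)) k" if "0 < k" "k \<le> 4 * s + 2" for k
  proof -
    have "m + 1 + 1 = m + 2" "m + 1 + 2 = m + 3" by simp_all
    note card = card_Std[of "m + 1" "wt (m + 2) + k", unfolded this]
    have "card (Std (wt (m + 2) + k)) = entry (row (m + 1)) (wt (m + 2) + k - wt (m + 1) - 1) + entry (row (m + 2)) k"
      using that s m by (subst card) (simp_all add: subset_sums_eq_row)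
    also have "wt (m + 2) + k - wt (m + 1) - 1 = 2 * s + 1 + k" using s by simp
    finally have "card (Std (wt (m + 2) + k)) = entry (row (m + 1)) (2 * s + 1 + k) + entry (row (m + 2)) k" .
    then show ?thesis using len(2) that by (simp add: entry_def)
  qed
  have "entry (row (m + 2)) s = entry (row (m + 2)) (s - p)"
    using per[of "wt (m + 2) + (s - p)"] eq[of s] eq[of "s - p"] big p s by simp
  moreover have "entry (row (m + 2)) (2 * s + 1) = entry (row (m + 2)) (2 * s + 1 - p)"
    using per[of "wt (m + 2) + (2 * s + 1 - p)"] eq[of "2 * s + 1"] eq[of "2 * s + 1 - p"] big p s by simp
  moreover have low: "entry (row (m + 2)) k = entry (row (m + 1)) k" if "k < 2 * s + 1" for k
    unfolding row2 entry_merge[OF row_ends(1,3,1,2)] using that len by simp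
  moreover have "entry (row (m + 1)) s = 1"
    using row_ends[of m] len(1) unfolding row1 by (simp add: entry_def nth_append last_conv_nth)
  moreover have "entry (row (m + 2)) (2 * s + 1) = 2"
  proof -
    have "entry (row (m + 1)) (2 * s + 1) = 1" "entry (row (m + 1)) 0 = 1"
      using row_ends[of "m + 1"] len(2) by (simp_all add: entry_def last_conv_nth hd_conv_nth)
    then show ?thesis unfolding row2 entry_merge[OF row_ends(1,3,1,2)] using len by simp
  qed
  \<comment> \<open>The positions s and 2s + 1 end the two copies of \<open>row m\<close>, each of
    length s + 1. Going back p places from either reaches the same position within its copy.\<close>
  moreover have "entry (row (m + 1)) (s - p) = entry (row (m + 1)) (2 * s + 1 - p)"
    unfolding row1 using len(1) big p by (simp add: entry_append) (simp add: entry_def)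
  ultimately show False using low[of s] low[of "s - p"] low[of "2 * s + 1 - p"] big p by simp
qed


theorem corollary11p2:
  fixes a :: "nat \<Rightarrow> nat"
  assumes char2: "CHAR('k::field) = 2"
    and a: "\<And>n. 1 \<le> n \<Longrightarrow> a n = endo.dim (lieR_component n :: ('k grassmann \<Rightarrow> 'k grassmann) set)"
  shows "(\<forall>n\<ge>1. quotient_dim (lieR_lower_central n :: ('k grassmann \<Rightarrow> 'k grassmann) set)
            (lieR_lower_central (n + 1)) (a n)) \<and>
    (\<exists>block :: nat \<Rightarrow> nat list.
      (\<forall>k. block k = [1, 1, 2] \<or> block k = [1, 1, 2, 2, 2]) \<and>
      (\<forall>k. \<forall>j < length (block k). a (5 + (\<Sum>i<k. length (block i)) + j) = block k ! j)) \<and>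
    \<not> (\<exists>N p. 0 < p \<and> (\<forall>n\<ge>N. a (n + p) = a n))"
proof (intro conjI allI impI)
  have a_eq: "a n = card (Std n)" if "1 \<le> n" for n
    using a[OF that] dim_lieR_component[OF char2] by simp
  show "quotient_dim (lieR_lower_central n :: ('k grassmann \<Rightarrow> 'k grassmann) set)
      (lieR_lower_central (n + 1)) (a n)" if n: "1 \<le> n" for n
  proof -
    obtain l where "n = Suc l" using n by (cases n) auto
    then show ?thesis
      using quotient_dim_filt[OF finite_Std, of n, where 'k = 'k]
        lieR_lower_central_eq_filt[OF char2, of l] lieR_lower_central_eq_filt[OF char2, of n]
        a_eq[OF n]
      by simp
  qed
  have a_5: "a (5 + i + j) = card (Std (5 + i + j))" for i j
    by (rule a_eq) simp
  show "\<exists>block :: nat \<Rightarrow> nat list.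
      (\<forall>k. block k = [1, 1, 2] \<or> block k = [1, 1, 2, 2, 2]) \<and>
      (\<forall>k. \<forall>j < length (block k). a (5 + (\<Sum>i<k. length (block i)) + j) = block k ! j)"
    unfolding a_5 by (rule card_Std_blocks)
  show "\<not> (\<exists>N p. 0 < p \<and> (\<forall>n\<ge>N. a (n + p) = a n))"
  proof
    assume "\<exists>N p. 0 < p \<and> (\<forall>n\<ge>N. a (n + p) = a n)"
    then obtain N p where "0 < p" "\<And>n. N \<le> n \<Longrightarrow> a (n + p) = a n" by blast
    \<comment> \<open>The values of a are prescribed only from 1 on, hence the shift to N +
      1.\<close>
    then have "card (Std (n + p)) = card (Std n)" if "N + 1 \<le> n" for n
      using that a_eq[of n] a_eq[of "n + p"] by simp
    then show False using card_Std_not_periodic \<open>0 < p\<close> by blast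
  qed
qed

end
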